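(* For the two-user BFIC with no CSIT with parameters $0\le p_d,p_c\le 1$ (model in the context), the capacity region $\mathcal{C}(p_d,p_c)$ is contained in $\bar{\mathcal{C}}(p_d,p_c)$, where: \begin{itemize} \item for $0 \le p_c \le \frac{p_d}{1+p_d}$: $\bar{\mathcal{C}}$ is the set of $(R_1,R_2)$ with $0\le R_i\le p_d$ for $i=1,2$ and $R_i + \beta R_{\bar i} \le \beta p_d + p_c - p_dp_c$ for $i=1,2$ ($\bar i=3-i$), where $\beta = \frac{p_d-p_c}{p_dp_c}$; \item for $\frac{p_d}{1+p_d}\le p_c\le p_d$: $\bar{\mathcal{C}}$ is the set of $(R_1,R_2)$ with $0\le R_i\le p_d$, $R_1+R_2\le 2p_c$, and $R_i + \frac{p_d}{p_c}R_{\bar i} \le \frac{p_d}{p_c}(p_d+p_c-p_dp_c)$ for $i=1,2$; \item for $p_d\le p_c\le 1$: $\bar{\mathcal{C}}$ is the set of $(R_1,R_2)$ with $0\le R_i\le p_d$ for $i=1,2$ and $R_1+R_2\le p_d+p_c-p_dp_c$. \end{itemize}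
   Context: Two-user BFIC: at each time $t$, transmitter ${\sf Tx}_i$ sends $X_i[t]\in\{0,1\}$ and receiver ${\sf Rx}_i$ receives $Y_i[t] = G_{ii}[t]X_i[t] \oplus G_{\bar i i}[t] X_{\bar i}[t]$, $i=1,2$, $\bar i = 3-i$, with arithmetic in $\mathbb{F}_2$. The channel gains $G_{ij}[t]\in\{0,1\}$ (from ${\sf Tx}_i$ to ${\sf Rx}_j$) are mutually independent Bernoulli random variables, independent over time, with $G_{ii}[t]\sim\mathcal{B}(p_d)$ and $G_{i\bar i}[t]\sim \mathcal{B}(p_c)$. ${\sf Tx}_i$ wishes to send a message $W_i$ uniform on $\{1,\dots,2^{nR_i}\}$ to ${\sf Rx}_i$ over $n$ channel uses; messages and channel gains are mutually independent. No CSIT: $X_i[t] = f_{i,t}(W_i)$. Receiver ${\sf Rx}_i$ decodes $\hat W_i = \varphi_i(Y_i^n, G_{ii}^n, G_{\bar i i}^n)$. A pair $(R_1,R_2)$ is achievable if there exist encoders/decoders with $\mathbb{E}[P(\hat W_i \ne W_i)]\to 0$ as $n\to\infty$ for $i=1,2$; $\mathcal{C}(p_d,p_c)$ is the closure of the set of achievable pairs.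
   Formalization: In the first region β = (p_d−p_c)/(p_d p_c) is undefined when p_c = 0 (or p_d = 0); in that case the two β-constraints are omitted, leaving 0 ≤ R_i ≤ p_d, which is their limit as β → ∞ when p_d > 0. *)

theory Defs
  imports "HOL-Analysis.Analysis"
begin

text \<open>Two-user binary fading interference channel (BFIC), no CSIT.
  A channel-gain symbol at one time instant is a tuple (G11, G12, G21, G22),
  where Gij is the gain from transmitter i to receiver j.
  G11, G22 ~ Bernoulli(pd); G12, G21 ~ Bernoulli(pc); all independent.\<close>

type_synonym gains = "bool \<times> bool \<times> bool \<times> bool"

definition bern :: "real \<Rightarrow> bool \<Rightarrow> real" where
  "bern p b = (if b then p else 1 - p)"

definition gain_prob :: "real \<Rightarrow> real \<Rightarrow> gains \<Rightarrow> real" where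
  "gain_prob pd pc g = (case g of (g11, g12, g21, g22) \<Rightarrow>
      bern pd g11 * bern pc g12 * bern pc g21 * bern pd g22)"

definition seq_prob :: "real \<Rightarrow> real \<Rightarrow> gains list \<Rightarrow> real" where
  "seq_prob pd pc gs = (\<Prod>g\<leftarrow>gs. gain_prob pd pc g)"

definition num_msgs :: "nat \<Rightarrow> real \<Rightarrow> nat" where
  "num_msgs n R = nat \<lceil>2 powr (real n * R)\<rceil>"

text \<open>Observations of receiver 1 and 2: at each time t the triple
  (Y_i[t], G_ii[t], G_{ibar i}[t]), with
  Y_1 = G11 X1 xor G21 X2, Y_2 = G22 X2 xor G12 X1 (xor on bool is \<noteq>).
  x1, x2 are the transmitted sequences (indexed by time).\<close>
definition obs1 :: "(nat \<Rightarrow> bool) \<Rightarrow> (nat \<Rightarrow> bool) \<Rightarrow> gains list \<Rightarrow> (bool \<times> bool \<times> bool) list" where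
  "obs1 x1 x2 gs = map (\<lambda>(t, (g11, g12, g21, g22)).
      (((g11 \<and> x1 t) \<noteq> (g21 \<and> x2 t)), g11, g21)) (zip [0..<length gs] gs)"

definition obs2 :: "(nat \<Rightarrow> bool) \<Rightarrow> (nat \<Rightarrow> bool) \<Rightarrow> gains list \<Rightarrow> (bool \<times> bool \<times> bool) list" where
  "obs2 x1 x2 gs = map (\<lambda>(t, (g11, g12, g21, g22)).
      (((g22 \<and> x2 t) \<noteq> (g12 \<and> x1 t)), g22, g12)) (zip [0..<length gs] gs)"

text \<open>Error probability of receiver 1 / 2, averaged over uniform independent
  messages W1 \<in> {0..<M1}, W2 \<in> {0..<M2} and over the channel gains
  (i.e. E[P(hat W_i \<noteq> W_i)]).  Encoders f_i : message \<Rightarrow> time \<Rightarrow> bit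
  (no CSIT), decoders \<phi>_i : observation sequence \<Rightarrow> message.\<close>
definition err1 :: "real \<Rightarrow> real \<Rightarrow> nat \<Rightarrow> nat \<Rightarrow> nat \<Rightarrow> (nat \<Rightarrow> nat \<Rightarrow> bool) \<Rightarrow> (nat \<Rightarrow> nat \<Rightarrow> bool)
     \<Rightarrow> ((bool \<times> bool \<times> bool) list \<Rightarrow> nat) \<Rightarrow> real" where
  "err1 pd pc n M1 M2 f1 f2 \<phi>1 =
     (\<Sum>w1<M1. \<Sum>w2<M2. \<Sum>gs\<in>{gs. length gs = n}.
        seq_prob pd pc gs / (real M1 * real M2) *
        (if \<phi>1 (obs1 (f1 w1) (f2 w2) gs) \<noteq> w1 then 1 else 0))"

definition err2 :: "real \<Rightarrow> real \<Rightarrow> nat \<Rightarrow> nat \<Rightarrow> nat \<Rightarrow> (nat \<Rightarrow> nat \<Rightarrow> bool) \<Rightarrow> (nat \<Rightarrow> nat \<Rightarrow> bool)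
     \<Rightarrow> ((bool \<times> bool \<times> bool) list \<Rightarrow> nat) \<Rightarrow> real" where
  "err2 pd pc n M1 M2 f1 f2 \<phi>2 =
     (\<Sum>w1<M1. \<Sum>w2<M2. \<Sum>gs\<in>{gs. length gs = n}.
        seq_prob pd pc gs / (real M1 * real M2) *
        (if \<phi>2 (obs2 (f1 w1) (f2 w2) gs) \<noteq> w2 then 1 else 0))"

definition achievable :: "real \<Rightarrow> real \<Rightarrow> real \<Rightarrow> real \<Rightarrow> bool" where
  "achievable pd pc R1 R2 \<longleftrightarrow> 0 \<le> R1 \<and> 0 \<le> R2 \<and>
     (\<exists>(f1 :: nat \<Rightarrow> nat \<Rightarrow> nat \<Rightarrow> bool) (f2 :: nat \<Rightarrow> nat \<Rightarrow> nat \<Rightarrow> bool)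
        (\<phi>1 :: nat \<Rightarrow> (bool \<times> bool \<times> bool) list \<Rightarrow> nat) (\<phi>2 :: nat \<Rightarrow> (bool \<times> bool \<times> bool) list \<Rightarrow> nat).
        (\<lambda>n. err1 pd pc n (num_msgs n R1) (num_msgs n R2) (f1 n) (f2 n) (\<phi>1 n)) \<longlonglongrightarrow> 0 \<and>
        (\<lambda>n. err2 pd pc n (num_msgs n R1) (num_msgs n R2) (f1 n) (f2 n) (\<phi>2 n)) \<longlonglongrightarrow> 0)"

definition capacity_region :: "real \<Rightarrow> real \<Rightarrow> (real \<times> real) set" where
  "capacity_region pd pc = closure {(R1, R2). achievable pd pc R1 R2}"

text \<open>Outer bound regions.  In region 1, beta = (pd - pc)/(pd pc) is finite only
  when pd pc > 0; the beta-constraint is imposed exactly in that case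
  (for pc = 0 it degenerates to no constraint, i.e. the limit beta \<rightarrow> \<infinity>).\<close>
definition outer1 :: "real \<Rightarrow> real \<Rightarrow> (real \<times> real) set" where
  "outer1 pd pc = (let \<beta> = (pd - pc) / (pd * pc) in
     {(R1, R2). 0 \<le> R1 \<and> R1 \<le> pd \<and> 0 \<le> R2 \<and> R2 \<le> pd \<and>
        (pd * pc \<noteq> 0 \<longrightarrow>
          R1 + \<beta> * R2 \<le> \<beta> * pd + pc - pd * pc \<and>
          R2 + \<beta> * R1 \<le> \<beta> * pd + pc - pd * pc)})"

definition outer2 :: "real \<Rightarrow> real \<Rightarrow> (real \<times> real) set" where
  "outer2 pd pc =
     {(R1, R2). 0 \<le> R1 \<and> R1 \<le> pd \<and> 0 \<le> R2 \<and> R2 \<le> pd \<and> R1 + R2 \<le> 2 * pc \<and>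
        R1 + (pd / pc) * R2 \<le> (pd / pc) * (pd + pc - pd * pc) \<and>
        R2 + (pd / pc) * R1 \<le> (pd / pc) * (pd + pc - pd * pc)}"

definition outer3 :: "real \<Rightarrow> real \<Rightarrow> (real \<times> real) set" where
  "outer3 pd pc =
     {(R1, R2). 0 \<le> R1 \<and> R1 \<le> pd \<and> 0 \<le> R2 \<and> R2 \<le> pd \<and> R1 + R2 \<le> pd + pc - pd * pc}"

end

theory Submission
  imports Defs
begin

text \<open>
  Write $h_i(p)$ for the entropy rate of the codeword of user $i$ when every position is kept
  independently with probability $p$. Since the entropy of a subset of positions is monotone and
  submodular, $h_i$ is nondecreasing and concave, and $0 \le h_i(p) \le p$.

  Fano's inequality gives $R_1 \le H(Y_1 | G)/n - h_2(p_c)$ up to a vanishing error. Put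
  $a = p_d (1 - p_c)$ and $r = p_c (1 - p_d)$. Bounding $H(Y_1 | G)$ by the entropies of the two
  separate signals, by splitting off the positions with $G_{11} = 1$, and by splitting the
  positions into interference-free, signal-free and collision ones yields
  $R_1 \le h_1(p_d)$, $R_1 \le p_d + h_2(r) - h_2(p_c)$ and
  $R_1 \le h_1(a) + h_2(r) + p_d p_c - h_2(p_c)$, and symmetrically for $R_2$.
  Every face of the three regions is a nonnegative combination of these inequalities and of the
  properties of $h_1$ and $h_2$. The only delicate one is the face with slope $\beta$, which adds
  the third bound on $R_1$ to $\beta - 1/\beta$ times the second and $1/\beta$ times the third
  bound on $R_2$, using that $p_c$ divides the segment from $r$ to $a$ in the ratio
  $1 : (\beta - 1)$.
\<close>

section \<open>Entropy of functions of a uniform random variable\<close>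

definition fiber :: "'a set \<Rightarrow> ('a \<Rightarrow> 'b) \<Rightarrow> 'a \<Rightarrow> 'a set" where
  "fiber \<Omega> X \<omega> = {\<omega>' \<in> \<Omega>. X \<omega>' = X \<omega>}"

text \<open>Shannon entropy in bits under the uniform law on \<open>\<Omega>\<close>, averaged over
  outcomes rather than values: \<open>card (fiber \<Omega> X \<omega>) / card \<Omega>\<close> is
  the probability of the value taken at \<open>\<omega>\<close>. Only the partition into fibers
  matters, so values may have any type.\<close>

definition entropy :: "'a set \<Rightarrow> ('a \<Rightarrow> 'b) \<Rightarrow> real" where
  "entropy \<Omega> X = (\<Sum>\<omega>\<in>\<Omega>. log 2 (card \<Omega> / card (fiber \<Omega> X \<omega>))) / card \<Omega>"

lemma card_fiber_pos: "finite \<Omega> \<Longrightarrow> \<omega> \<in> \<Omega> \<Longrightarrow> 0 < card (fiber \<Omega> X \<omega>)"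
  unfolding fiber_def by (subst card_gt_0_iff) auto

text \<open>If \<open>Y\<close> is a function of \<open>X\<close>, the fibers of \<open>X\<close>
  refine those of \<open>Y\<close>, and smaller fibers mean larger surprisal at each
  outcome.\<close>

lemma entropy_mono:
  assumes "finite \<Omega>" and "\<And>\<omega> \<omega>'. \<omega> \<in> \<Omega> \<Longrightarrow> \<omega>' \<in> \<Omega> \<Longrightarrow> X \<omega> = X \<omega>' \<Longrightarrow> Y \<omega> = Y \<omega>'"
  shows "entropy \<Omega> Y \<le> entropy \<Omega> X"
proof -
  have "log 2 (card \<Omega> / card (fiber \<Omega> Y \<omega>)) \<le> log 2 (card \<Omega> / card (fiber \<Omega> X \<omega>))"
    if "\<omega> \<in> \<Omega>" for \<omega>
  proof -
    have "fiber \<Omega> X \<omega> \<subseteq> fiber \<Omega> Y \<omega>"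
      using assms(2)[OF _ that] unfolding fiber_def by blast
    then have "card (fiber \<Omega> X \<omega>) \<le> card (fiber \<Omega> Y \<omega>)"
      using assms(1) by (intro card_mono) (simp_all add: fiber_def)
    moreover have "0 < card \<Omega>" using assms(1) that by (auto simp: card_gt_0_iff)
    ultimately have "real (card \<Omega>) / card (fiber \<Omega> Y \<omega>) \<le> real (card \<Omega>) / card (fiber \<Omega> X \<omega>)"
        "0 < real (card \<Omega>) / card (fiber \<Omega> Y \<omega>)"
      using card_fiber_pos[OF assms(1) that, of X] card_fiber_pos[OF assms(1) that, of Y]
      by (simp_all add: frac_le)
    then show ?thesis by (intro log_mono) simp_all
  qed
  then show ?thesis unfolding entropy_def by (intro divide_right_mono sum_mono) simp_all
qed

lemma entropy_cong:
  assumes "finite \<Omega>"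
    and "\<And>\<omega> \<omega>'. \<omega> \<in> \<Omega> \<Longrightarrow> \<omega>' \<in> \<Omega> \<Longrightarrow> X \<omega> = X \<omega>' \<longleftrightarrow> Y \<omega> = Y \<omega>'"
  shows "entropy \<Omega> Y = entropy \<Omega> X"
proof (rule antisym)
  show "entropy \<Omega> Y \<le> entropy \<Omega> X" by (rule entropy_mono[OF assms(1)]) (simp add: assms(2))
  show "entropy \<Omega> X \<le> entropy \<Omega> Y" by (rule entropy_mono[OF assms(1)]) (simp add: assms(2))
qed

lemma entropy_nonneg: "finite \<Omega> \<Longrightarrow> 0 \<le> entropy \<Omega> X"
proof -
  assume fin: "finite \<Omega>"
  have "entropy \<Omega> (\<lambda>_. ()) = 0"
    by (cases "\<Omega> = {}") (auto simp: entropy_def fiber_def)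
  with entropy_mono[OF fin, of X "\<lambda>_. ()"] show ?thesis by simp
qed

section \<open>Gibbs' inequality and its consequences\<close>

lemma sum_inverse_card_fiber:
  assumes fin: "finite \<Omega>"
  shows "(\<Sum>\<omega>\<in>\<Omega>. g (X \<omega>) / real (card (fiber \<Omega> X \<omega>))) = (\<Sum>x\<in>X ` \<Omega>. g x)"
proof -
  have "(\<Sum>\<omega>\<in>\<Omega>. g (X \<omega>) / real (card (fiber \<Omega> X \<omega>)))
      = (\<Sum>x\<in>X ` \<Omega>. \<Sum>\<omega>\<in>{\<omega>\<in>\<Omega>. X \<omega> = x}. g (X \<omega>) / real (card (fiber \<Omega> X \<omega>)))"
    by (rule sum.image_gen[OF fin])
  also have "\<dots> = (\<Sum>x\<in>X ` \<Omega>. g x)"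
  proof (rule sum.cong[OF refl])
    fix x assume "x \<in> X ` \<Omega>"
    then obtain \<omega>0 where w: "\<omega>0 \<in> \<Omega>" "X \<omega>0 = x" by auto
    have eq: "fiber \<Omega> X \<omega> = {\<omega>\<in>\<Omega>. X \<omega> = x}" if "X \<omega> = x" for \<omega>
      using that by (auto simp: fiber_def)
    have "(\<Sum>\<omega>\<in>{\<omega>\<in>\<Omega>. X \<omega> = x}. g (X \<omega>) / real (card (fiber \<Omega> X \<omega>)))
       = (\<Sum>\<omega>\<in>{\<omega>\<in>\<Omega>. X \<omega> = x}. g x / real (card {\<omega>\<in>\<Omega>. X \<omega> = x}))"
      by (intro sum.cong) (auto simp: eq)
    also have "\<dots> = g x" using card_fiber_pos[OF fin w(1), of X] eq[OF w(2)] by simp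
    finally show "(\<Sum>\<omega>\<in>{\<omega>\<in>\<Omega>. X \<omega> = x}. g (X \<omega>) / real (card (fiber \<Omega> X \<omega>))) = g x" .
  qed
  finally show ?thesis .
qed

text \<open>Comes from \<open>ln t \<le> t - 1\<close>, applied to the ratio of a guessed
  conditional probability \<open>q w y\<close> to the true one. Fano's inequality, submodularity and
  the cardinality bound are each obtained below by a choice of \<open>q\<close>.\<close>

lemma conditional_gibbs:
  fixes q :: "'b \<Rightarrow> 'c \<Rightarrow> real"
  assumes fin: "finite \<Omega>"
    and pos: "\<And>\<omega>. \<omega> \<in> \<Omega> \<Longrightarrow> 0 < q (W \<omega>) (Y \<omega>)"
    and nonneg: "\<And>w y. w \<in> W ` \<Omega> \<Longrightarrow> y \<in> Y ` \<Omega> \<Longrightarrow> 0 \<le> q w y"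
    and le1: "\<And>y. y \<in> Y ` \<Omega> \<Longrightarrow> (\<Sum>w\<in>W ` \<Omega>. q w y) \<le> 1"
  shows "entropy \<Omega> (\<lambda>\<omega>. (W \<omega>, Y \<omega>)) - entropy \<Omega> Y
    \<le> (\<Sum>\<omega>\<in>\<Omega>. - log 2 (q (W \<omega>) (Y \<omega>))) / card \<Omega>"
proof (cases "\<Omega> = {}")
  case False
  let ?Z = "\<lambda>\<omega>. (W \<omega>, Y \<omega>)"
  define c where "c = (\<lambda>y. real (card {\<omega>\<in>\<Omega>. Y \<omega> = y}))"
  define k where "k = (\<lambda>\<omega>. real (card (fiber \<Omega> ?Z \<omega>)))"
  have kpos: "0 < k \<omega>" if "\<omega> \<in> \<Omega>" for \<omega> using card_fiber_pos[OF fin that] by (simp add: k_def)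
  have cpos: "0 < c (Y \<omega>)" if "\<omega> \<in> \<Omega>" for \<omega>
    using card_fiber_pos[OF fin that, of Y] by (simp add: c_def fiber_def)
  have N: "0 < card \<Omega>" using False fin by (simp add: card_gt_0_iff)
  \<comment> \<open>Here \<open>k \<omega> / c (Y \<omega>)\<close> is the true conditional
    probability, so the summand is guess over truth. Grouping outcomes by value shows that its mean
    is at most 1.\<close>
  have "(\<Sum>\<omega>\<in>\<Omega>. q (W \<omega>) (Y \<omega>) * c (Y \<omega>) / k \<omega>) = (\<Sum>z\<in>?Z ` \<Omega>. q (fst z) (snd z) * c (snd z))"
    using sum_inverse_card_fiber[OF fin, of "\<lambda>z. q (fst z) (snd z) * c (snd z)" ?Z]
    by (simp add: k_def)
  also have "\<dots> \<le> (\<Sum>z\<in>W ` \<Omega> \<times> Y ` \<Omega>. q (fst z) (snd z) * c (snd z))"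
    using fin nonneg by (intro sum_mono2) (auto simp: c_def)
  also have "\<dots> = (\<Sum>y\<in>Y ` \<Omega>. (\<Sum>w\<in>W ` \<Omega>. q w y) * c y)"
    unfolding sum_distrib_right by (subst sum.swap) (simp add: sum.cartesian_product split_beta)
  also have "\<dots> \<le> (\<Sum>y\<in>Y ` \<Omega>. 1 * c y)"
    using le1 by (intro sum_mono mult_right_mono) (auto simp: c_def)
  also have "\<dots> = card \<Omega>"
    using sum.image_gen[OF fin, of "\<lambda>_. 1::real" Y] by (simp add: c_def)
  finally have total: "(\<Sum>\<omega>\<in>\<Omega>. q (W \<omega>) (Y \<omega>) * c (Y \<omega>) / k \<omega>) \<le> card \<Omega>" .
  have "log 2 (card \<Omega> / k \<omega>) - log 2 (card \<Omega> / c (Y \<omega>)) + log 2 (q (W \<omega>) (Y \<omega>))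
      \<le> (q (W \<omega>) (Y \<omega>) * c (Y \<omega>) / k \<omega> - 1) / ln 2" if w: "\<omega> \<in> \<Omega>" for \<omega>
  proof -
    have "ln (q (W \<omega>) (Y \<omega>) * c (Y \<omega>) / k \<omega>) \<le> q (W \<omega>) (Y \<omega>) * c (Y \<omega>) / k \<omega> - 1"
      using pos[OF w] kpos[OF w] cpos[OF w] by (intro ln_le_minus_one) simp
    then have "ln (q (W \<omega>) (Y \<omega>) * c (Y \<omega>) / k \<omega>) / ln 2
        \<le> (q (W \<omega>) (Y \<omega>) * c (Y \<omega>) / k \<omega> - 1) / ln 2"
      by (intro divide_right_mono) auto
    moreover have "log 2 (card \<Omega> / k \<omega>) - log 2 (card \<Omega> / c (Y \<omega>)) + log 2 (q (W \<omega>) (Y \<omega>))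
        = ln (q (W \<omega>) (Y \<omega>) * c (Y \<omega>) / k \<omega>) / ln 2"
      using pos[OF w] kpos[OF w] cpos[OF w] N
      by (simp add: log_def ln_div ln_mult diff_divide_distrib add_divide_distrib)
    ultimately show ?thesis by simp
  qed
  then have "(\<Sum>\<omega>\<in>\<Omega>. log 2 (card \<Omega> / k \<omega>) - log 2 (card \<Omega> / c (Y \<omega>)) + log 2 (q (W \<omega>) (Y \<omega>)))
      \<le> (\<Sum>\<omega>\<in>\<Omega>. (q (W \<omega>) (Y \<omega>) * c (Y \<omega>) / k \<omega> - 1) / ln 2)"
    by (rule sum_mono)
  also have "\<dots> \<le> 0"
    using total by (simp add: sum_divide_distrib[symmetric] sum_subtractf divide_le_0_iff)
  finally have "(\<Sum>\<omega>\<in>\<Omega>. log 2 (card \<Omega> / k \<omega>)) - (\<Sum>\<omega>\<in>\<Omega>. log 2 (card \<Omega> / c (Y \<omega>)))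
      \<le> (\<Sum>\<omega>\<in>\<Omega>. - log 2 (q (W \<omega>) (Y \<omega>)))"
    by (simp add: sum.distrib sum_subtractf sum_negf)
  then show ?thesis
    unfolding entropy_def k_def c_def fiber_def diff_divide_distrib[symmetric]
    by (intro divide_right_mono) auto
qed (simp add: entropy_def)

lemma entropy_fano:
  assumes fin: "finite \<Omega>" and ne: "\<Omega> \<noteq> {}" and W: "\<And>\<omega>. \<omega> \<in> \<Omega> \<Longrightarrow> W \<omega> < (M::nat)"
  shows "entropy \<Omega> (\<lambda>\<omega>. (W \<omega>, Y \<omega>)) - entropy \<Omega> Y
    \<le> 1 + card {\<omega>\<in>\<Omega>. \<phi> (Y \<omega>) \<noteq> W \<omega>} / card \<Omega> * log 2 M"
proof -
  \<comment> \<open>The guess puts mass 1/2 on the decoded message and \<open>1 / (2 * M)\<close> on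
    each other one. A correct decision then costs 1 bit and an error \<open>1 + log 2 M\<close>
    bits.\<close>
  define q :: "nat \<Rightarrow> _ \<Rightarrow> real" where "q = (\<lambda>w y. if \<phi> y = w then 1/2 else 1 / (2 * M))"
  have M: "0 < M" using ne W by fastforce
  have sub: "W ` \<Omega> \<subseteq> {..<M}" using W by auto
  have N: "0 < card \<Omega>" using ne fin by (simp add: card_gt_0_iff)
  have "(\<Sum>w\<in>W ` \<Omega>. q w y) \<le> 1" for y
  proof -
    have "(\<Sum>w\<in>W ` \<Omega>. q w y) \<le> (\<Sum>w\<in>{..<M}. (if \<phi> y = w then 1/2 else 0) + 1 / (2 * M))"
      using sub by (intro order.trans[OF sum_mono2[of "{..<M}"] sum_mono]) (auto simp: q_def)
    also have "\<dots> \<le> 1" using M by (auto simp: sum.distrib)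
    finally show ?thesis .
  qed
  then have "entropy \<Omega> (\<lambda>\<omega>. (W \<omega>, Y \<omega>)) - entropy \<Omega> Y
    \<le> (\<Sum>\<omega>\<in>\<Omega>. - log 2 (q (W \<omega>) (Y \<omega>))) / card \<Omega>"
    using M by (intro conditional_gibbs[OF fin]) (auto simp: q_def)
  also have "(\<Sum>\<omega>\<in>\<Omega>. - log 2 (q (W \<omega>) (Y \<omega>)))
     = (\<Sum>\<omega>\<in>\<Omega>. 1 + (if \<phi> (Y \<omega>) \<noteq> W \<omega> then log 2 M else 0))"
    using M by (intro sum.cong) (auto simp: q_def log_divide log_mult)
  also have "\<dots> = card \<Omega> + card {\<omega>\<in>\<Omega>. \<phi> (Y \<omega>) \<noteq> W \<omega>} * log 2 M"
    using fin by (simp add: sum.distrib sum.If_cases Int_def)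
  finally show ?thesis using N by (simp add: add_divide_distrib)
qed

lemma entropy_submodular:
  assumes fin: "finite \<Omega>"
  shows "entropy \<Omega> (\<lambda>\<omega>. (X \<omega>, Y \<omega>, Z \<omega>)) - entropy \<Omega> (\<lambda>\<omega>. (Y \<omega>, Z \<omega>))
    \<le> entropy \<Omega> (\<lambda>\<omega>. (X \<omega>, Z \<omega>)) - entropy \<Omega> Z"
proof (cases "\<Omega> = {}")
  case False
  define c where "c = (\<lambda>z. real (card {\<omega>\<in>\<Omega>. Z \<omega> = z}))"
  define d where "d = (\<lambda>x z. real (card {\<omega>\<in>\<Omega>. X \<omega> = x \<and> Z \<omega> = z}))"
  have N: "0 < card \<Omega>" using False fin by (simp add: card_gt_0_iff)
  have cpos: "0 < c (Z \<omega>)" and dpos: "0 < d (X \<omega>) (Z \<omega>)" if "\<omega> \<in> \<Omega>" for \<omega>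
    using card_fiber_pos[OF fin that, of Z] card_fiber_pos[OF fin that, of "\<lambda>\<omega>. (X \<omega>, Z \<omega>)"]
    by (auto simp: c_def d_def fiber_def)
  have sumd: "(\<Sum>x\<in>X ` \<Omega>. d x z) = c z" for z
  proof -
    have "c z = card (\<Union>x\<in>X ` \<Omega>. {\<omega>\<in>\<Omega>. X \<omega> = x \<and> Z \<omega> = z})"
      unfolding c_def by (intro arg_cong[where f = "\<lambda>A. real (card A)"]) auto
    also have "\<dots> = (\<Sum>x\<in>X ` \<Omega>. card {\<omega>\<in>\<Omega>. X \<omega> = x \<and> Z \<omega> = z})"
      using fin by (subst card_UN_disjoint) auto
    finally show ?thesis by (simp add: d_def)
  qed
  \<comment> \<open>The guess for \<open>X\<close> given \<open>(Y, Z)\<close> is the true law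
    \<open>d x z / c z\<close> of \<open>X\<close> given \<open>Z\<close> alone; its cross entropy
    is exactly the conditional entropy given \<open>Z\<close>.\<close>
  have "entropy \<Omega> (\<lambda>\<omega>. (X \<omega>, Y \<omega>, Z \<omega>)) - entropy \<Omega> (\<lambda>\<omega>. (Y \<omega>, Z \<omega>))
    \<le> (\<Sum>\<omega>\<in>\<Omega>. - log 2 ((\<lambda>x (y, z). d x z / c z) (X \<omega>) (Y \<omega>, Z \<omega>))) / card \<Omega>"
  proof (rule conditional_gibbs[OF fin])
    fix yz assume "yz \<in> (\<lambda>\<omega>. (Y \<omega>, Z \<omega>)) ` \<Omega>"
    then show "(\<Sum>x\<in>X ` \<Omega>. (\<lambda>(y, z). d x z / c z) yz) \<le> 1"
      using cpos by (auto simp: sum_divide_distrib[symmetric] sumd)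
  qed (use cpos dpos in \<open>auto simp: c_def d_def\<close>)
  also have "(\<Sum>\<omega>\<in>\<Omega>. - log 2 ((\<lambda>x (y, z). d x z / c z) (X \<omega>) (Y \<omega>, Z \<omega>)))
     = (\<Sum>\<omega>\<in>\<Omega>. log 2 (card \<Omega> / d (X \<omega>) (Z \<omega>)) - log 2 (card \<Omega> / c (Z \<omega>)))"
  proof (rule sum.cong[OF refl])
    fix \<omega> assume w: "\<omega> \<in> \<Omega>"
    show "- log 2 ((\<lambda>x (y, z). d x z / c z) (X \<omega>) (Y \<omega>, Z \<omega>))
      = log 2 (card \<Omega> / d (X \<omega>) (Z \<omega>)) - log 2 (card \<Omega> / c (Z \<omega>))"
      using cpos[OF w] dpos[OF w] N by (simp add: log_divide)
  qed
  also have "\<dots> / card \<Omega> = entropy \<Omega> (\<lambda>\<omega>. (X \<omega>, Z \<omega>)) - entropy \<Omega> Z"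
    by (simp add: entropy_def fiber_def c_def d_def sum_subtractf diff_divide_distrib)
  finally show ?thesis .
qed (simp add: entropy_def)

lemma entropy_subadditive:
  assumes "finite \<Omega>"
  shows "entropy \<Omega> (\<lambda>\<omega>. (X \<omega>, Y \<omega>)) \<le> entropy \<Omega> X + entropy \<Omega> Y"
proof -
  have "entropy \<Omega> (\<lambda>\<omega>. (X \<omega>, Y \<omega>, ())) = entropy \<Omega> (\<lambda>\<omega>. (X \<omega>, Y \<omega>))"
    "entropy \<Omega> (\<lambda>\<omega>. (Y \<omega>, ())) = entropy \<Omega> Y" "entropy \<Omega> (\<lambda>\<omega>. (X \<omega>, ())) = entropy \<Omega> X"
    using assms by (auto intro: entropy_cong)
  with entropy_submodular[OF assms, of X Y "\<lambda>_. ()"] entropy_nonneg[OF assms, of "\<lambda>_. ()"]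
  show ?thesis by simp
qed

lemma entropy_le_log_card:
  assumes fin: "finite \<Omega>" "finite B" and sub: "X ` \<Omega> \<subseteq> B" and ne: "B \<noteq> {}"
  shows "entropy \<Omega> X \<le> log 2 (card B)"
proof (cases "\<Omega> = {}")
  case False
  have N: "0 < card \<Omega>" using False fin by (simp add: card_gt_0_iff)
  have B: "0 < card B" using ne fin by (simp add: card_gt_0_iff)
  \<comment> \<open>The guess is the uniform law on \<open>B\<close>, with a trivial conditioning
    variable.\<close>
  have "entropy \<Omega> (\<lambda>\<omega>. (X \<omega>, ())) - entropy \<Omega> (\<lambda>_. ())
    \<le> (\<Sum>\<omega>\<in>\<Omega>. - log 2 (1 / card B)) / card \<Omega>"
  proof (rule conditional_gibbs[OF fin(1)])
    show "(\<Sum>w\<in>X ` \<Omega>. 1 / real (card B)) \<le> 1"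
      using B card_mono[OF fin(2) sub] by (simp add: divide_le_eq)
  qed (use B in auto)
  moreover have "entropy \<Omega> (\<lambda>\<omega>. (X \<omega>, ())) = entropy \<Omega> X" "entropy \<Omega> (\<lambda>_. ()) = 0"
    using fin False by (auto intro: entropy_cong simp: entropy_def fiber_def)
  ultimately show ?thesis using N B by (simp add: log_divide)
next
  case True
  then show ?thesis using ne fin by (simp add: entropy_def card_gt_0_iff Suc_le_eq)
qed

lemma entropy_inj_on: "finite \<Omega> \<Longrightarrow> \<Omega> \<noteq> {} \<Longrightarrow> inj_on X \<Omega> \<Longrightarrow> entropy \<Omega> X = log 2 (card \<Omega>)"
proof -
  assume fin: "finite \<Omega>" and ne: "\<Omega> \<noteq> {}" and inj: "inj_on X \<Omega>"
  have "fiber \<Omega> X \<omega> = {\<omega>}" if "\<omega> \<in> \<Omega>" for \<omega>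
    using inj that by (auto simp: fiber_def inj_on_def)
  then show ?thesis using fin ne by (simp add: entropy_def)
qed

text \<open>Independence: on a product space the fiber of a pair is the product of the fibers, so
  surprisals add.\<close>

lemma entropy_product:
  assumes fin: "finite \<Omega>" "finite \<Omega>'" and ne: "\<Omega> \<noteq> {}" "\<Omega>' \<noteq> {}"
  shows "entropy (\<Omega> \<times> \<Omega>') (\<lambda>\<omega>. (X (fst \<omega>), Y (snd \<omega>))) = entropy \<Omega> X + entropy \<Omega>' Y"
proof -
  define K where "K = real (card \<Omega>)"
  define K' where "K' = real (card \<Omega>')"
  have K: "0 < K" "0 < K'" using assms by (auto simp: K_def K'_def card_gt_0_iff)
  have "fiber (\<Omega> \<times> \<Omega>') (\<lambda>\<omega>. (X (fst \<omega>), Y (snd \<omega>))) (u, v) = fiber \<Omega> X u \<times> fiber \<Omega>' Y v" for u v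
    by (auto simp: fiber_def)
  then have "entropy (\<Omega> \<times> \<Omega>') (\<lambda>\<omega>. (X (fst \<omega>), Y (snd \<omega>)))
    = (\<Sum>u\<in>\<Omega>. \<Sum>v\<in>\<Omega>'. log 2 (K / card (fiber \<Omega> X u)) + log 2 (K' / card (fiber \<Omega>' Y v))) / (K * K')"
    unfolding entropy_def sum.cartesian_product card_cartesian_product of_nat_mult K_def K'_def
    using card_fiber_pos[OF fin(1), of _ X] card_fiber_pos[OF fin(2), of _ Y] ne fin
    by (intro arg_cong2[where f = "(/)"] sum.cong)
       (auto simp: card_cartesian_product log_divide log_mult card_gt_0_iff)
  then show ?thesis using K
    by (simp add: entropy_def sum.distrib K_def[symmetric] K'_def[symmetric]
        sum_distrib_left[symmetric] field_simps)
qed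

lemma entropy_fst:
  assumes "finite \<Omega>" "finite \<Omega>'" "\<Omega> \<noteq> {}" "\<Omega>' \<noteq> {}"
  shows "entropy (\<Omega> \<times> \<Omega>') (\<lambda>\<omega>. X (fst \<omega>)) = entropy \<Omega> X"
proof -
  have "entropy \<Omega>' (\<lambda>_. ()) = 0"
    using assms by (auto simp: entropy_def fiber_def)
  moreover have "entropy (\<Omega> \<times> \<Omega>') (\<lambda>\<omega>. (X (fst \<omega>), ())) = entropy (\<Omega> \<times> \<Omega>') (\<lambda>\<omega>. X (fst \<omega>))"
    using assms by (intro entropy_cong) auto
  ultimately show ?thesis using entropy_product[OF assms, of X "\<lambda>_. ()"] by simp
qed

lemma entropy_snd:
  assumes "finite \<Omega>" "finite \<Omega>'" "\<Omega> \<noteq> {}" "\<Omega>' \<noteq> {}"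
  shows "entropy (\<Omega> \<times> \<Omega>') (\<lambda>\<omega>. Y (snd \<omega>)) = entropy \<Omega>' Y"
proof -
  have "entropy \<Omega> (\<lambda>_. ()) = 0"
    using assms by (auto simp: entropy_def fiber_def)
  moreover have "entropy (\<Omega> \<times> \<Omega>') (\<lambda>\<omega>. ((), Y (snd \<omega>))) = entropy (\<Omega> \<times> \<Omega>') (\<lambda>\<omega>. Y (snd \<omega>))"
    using assms by (intro entropy_cong) auto
  ultimately show ?thesis using entropy_product[OF assms, of "\<lambda>_. ()" Y] by simp
qed

section \<open>Random subsets\<close>

text \<open>The expectation of \<open>F A\<close> when the random set \<open>A\<close> keeps each
  position below \<open>n\<close> independently with probability \<open>p\<close>. The recursion
  reveals position \<open>n\<close> first, which makes inductions generalise over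
  \<open>F\<close>.\<close>

primrec thinning :: "real \<Rightarrow> nat \<Rightarrow> (nat set \<Rightarrow> real) \<Rightarrow> real" where
  "thinning p 0 F = F {}"
| "thinning p (Suc n) F = p * thinning p n (\<lambda>A. F (insert n A)) + (1 - p) * thinning p n F"

lemma thinning_mono:
  assumes "0 \<le> p" "p \<le> 1" "\<And>A. A \<subseteq> {..<n} \<Longrightarrow> F A \<le> G A"
  shows "thinning p n F \<le> thinning p n G"
  using assms(3)
proof (induction n arbitrary: F G)
  case (Suc n)
  have "F (insert n A) \<le> G (insert n A)" "F A \<le> G A" if "A \<subseteq> {..<n}" for A
    using that by (auto intro!: Suc.prems simp: lessThan_Suc)
  then have "thinning p n (\<lambda>A. F (insert n A)) \<le> thinning p n (\<lambda>A. G (insert n A))"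
    "thinning p n F \<le> thinning p n G"
    by (auto intro!: Suc.IH)
  then show ?case using assms(1,2) by (simp add: add_mono mult_left_mono)
qed simp

lemma thinning_cong:
  assumes "\<And>A. A \<subseteq> {..<n} \<Longrightarrow> F A = G A"
  shows "thinning p n F = thinning p n G"
  using assms
proof (induction n arbitrary: F G)
  case (Suc n)
  have "F (insert n A) = G (insert n A)" "F A = G A" if "A \<subseteq> {..<n}" for A
    using that by (auto intro!: Suc.prems simp: lessThan_Suc)
  then have "thinning p n (\<lambda>A. F (insert n A)) = thinning p n (\<lambda>A. G (insert n A))"
    "thinning p n F = thinning p n G"
    by (auto intro!: Suc.IH)
  then show ?case by simp
qed simp

lemma thinning_diff: "thinning p n (\<lambda>A. F A - G A) = thinning p n F - thinning p n G"
  by (induction n arbitrary: F G) (simp_all add: right_diff_distrib)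

lemma thinning_const: "thinning p n (\<lambda>_. c) = c"
  by (induction n) (auto simp: algebra_simps)

lemma thinning_card: "thinning p n (\<lambda>A. real (card A)) = p * n"
proof (induction n)
  case (Suc n)
  \<comment> \<open>Adding 1 is written as subtracting \<open>-1\<close> so that
    \<open>thinning_diff\<close> applies.\<close>
  have "thinning p n (\<lambda>A. real (card (insert n A))) = thinning p n (\<lambda>A. real (card A) - (-1))"
  proof (rule thinning_cong)
    fix A assume "A \<subseteq> {..<n}"
    then have "finite A" "n \<notin> A" using finite_subset by auto
    then show "real (card (insert n A)) = real (card A) - (-1)" by simp
  qed
  with Suc show ?case by (simp only: thinning.simps thinning_diff thinning_const) (simp add: algebra_simps)
qed simp

lemma thinning_antimono:
  assumes "0 \<le> p" "p \<le> q" "q \<le> 1" "antimono F"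
  shows "thinning q n F \<le> thinning p n F"
  using assms(4)
proof (induction n arbitrary: F)
  case (Suc n)
  let ?G = "\<lambda>A. F (insert n A)"
  have anti: "antimono ?G" using Suc.prems by (intro antimonoI antimonoD[OF Suc.prems] insert_mono)
  have GF: "thinning q n ?G \<le> thinning q n F"
    using assms by (intro thinning_mono antimonoD[OF Suc.prems]) auto
  \<comment> \<open>Passing from \<open>p\<close> to \<open>q\<close> moves weight
    \<open>q - p\<close> onto the branch that contains \<open>n\<close>, where an antitone function
    is smaller on average.\<close>
  have "q * thinning q n ?G + (1 - q) * thinning q n F
      = p * thinning q n ?G + (1 - p) * thinning q n F - (q - p) * (thinning q n F - thinning q n ?G)"
    by (simp add: algebra_simps)
  also have "\<dots> \<le> p * thinning q n ?G + (1 - p) * thinning q n F"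
    using GF assms by simp
  also have "\<dots> \<le> p * thinning p n ?G + (1 - p) * thinning p n F"
    using assms Suc.IH[OF anti] Suc.IH[OF Suc.prems] by (intro add_mono mult_left_mono) auto
  finally show ?case by simp
qed simp

lemma thinning_mono_prob:
  assumes "0 \<le> p" "p \<le> q" "q \<le> 1" "mono F"
  shows "thinning p n F \<le> thinning q n F"
proof -
  have "thinning q n (\<lambda>A. 0 - F A) \<le> thinning p n (\<lambda>A. 0 - F A)"
    using assms by (intro thinning_antimono) (auto simp: monotone_def)
  then show ?thesis by (simp add: thinning_diff thinning_const del: diff_0)
qed

text \<open>The slope in \<open>p\<close> is an expected increment of \<open>F\<close>, and
  submodularity makes increments shrink as the random set grows. The induction expresses this
  without derivatives.\<close>

lemma thinning_concave:
  assumes "0 \<le> p" "p \<le> s" "s \<le> 1" "0 \<le> l" "l \<le> 1"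
    and "\<And>t. antimono (\<lambda>A. F (insert t A) - F A)"
  shows "(1 - l) * thinning p n F + l * thinning s n F \<le> thinning ((1 - l) * p + l * s) n F"
  using assms(6)
proof (induction n arbitrary: F)
  case (Suc n)
  let ?G = "\<lambda>A. F (insert n A)"
  define q where "q = (1 - l) * p + l * s"
  have "q = p + l * (s - p)" "q = s - (1 - l) * (s - p)" by (auto simp: q_def algebra_simps)
  then have q: "0 \<le> q" "q \<le> 1"
    using assms(1-5) mult_nonneg_nonneg[of l "s - p"] mult_nonneg_nonneg[of "1 - l" "s - p"] by linarith+
  have sub: "antimono (\<lambda>A. ?G (insert t A) - ?G A)" for t
    using antimonoD[OF Suc.prems[of t] insert_mono[of _ _ n]]
    by (intro antimonoI) (simp only: insert_commute[of t])
  have "thinning s n (\<lambda>A. ?G A - F A) \<le> thinning p n (\<lambda>A. ?G A - F A)"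
    using assms Suc.prems by (intro thinning_antimono) auto
  then have D: "0 \<le> (thinning p n ?G - thinning p n F) - (thinning s n ?G - thinning s n F)"
    by (simp add: thinning_diff)
  \<comment> \<open>The gap in the next estimate is exactly \<open>l * (1 - l) * (s - p)\<close>
    times the quantity in \<open>D\<close>, the drop of the expected increment of position
    \<open>n\<close> between \<open>p\<close> and \<open>s\<close>.\<close>
  have "0 \<le> l * (1 - l) * (s - p)" using assms by simp
  from mult_nonneg_nonneg[OF this D]
  have "(1 - l) * thinning p (Suc n) F + l * thinning s (Suc n) F
    \<le> q * ((1 - l) * thinning p n ?G + l * thinning s n ?G)
       + (1 - q) * ((1 - l) * thinning p n F + l * thinning s n F)"
    by (simp add: q_def algebra_simps power2_eq_square)
  also have "\<dots> \<le> q * thinning q n ?G + (1 - q) * thinning q n F"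
    using q Suc.IH[OF sub] Suc.IH[OF Suc.prems] unfolding q_def[symmetric]
    by (intro add_mono mult_left_mono) auto
  finally show ?case by (simp add: q_def)
qed (simp add: algebra_simps)

text \<open>The codeword restricted to \<open>A\<close> is recorded as the set of positions in
  \<open>A\<close> that carry a one; for known \<open>A\<close> this determines the restricted
  bits.\<close>

definition codeword_entropy :: "nat \<Rightarrow> (nat \<Rightarrow> nat \<Rightarrow> bool) \<Rightarrow> nat set \<Rightarrow> real" where
  "codeword_entropy M f A = entropy {..<M} (\<lambda>w. {t \<in> A. f w t})"

lemma mono_codeword_entropy: "mono (codeword_entropy M f)"
proof (rule monoI)
  fix A B :: "nat set" assume "A \<subseteq> B"
  then show "codeword_entropy M f A \<le> codeword_entropy M f B"
    unfolding codeword_entropy_def by (intro entropy_mono) blast+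
qed

text \<open>The increment is the conditional entropy of bit \<open>t\<close> given the bits in
  \<open>A\<close>, and conditioning on more bits lowers it.\<close>

lemma antimono_codeword_entropy_increment:
  "antimono (\<lambda>A. codeword_entropy M f (insert t A) - codeword_entropy M f A)"
proof (rule antimonoI)
  fix A B :: "nat set" assume AB: "A \<subseteq> B"
  \<comment> \<open>The bits in \<open>A\<close> are already determined by those in
    \<open>B\<close>; listing them again gives the shape of
    \<open>entropy_submodular\<close>.\<close>
  have "codeword_entropy M f (insert t B)
      = entropy {..<M} (\<lambda>w. (f w t, {s \<in> B. f w s}, {s \<in> A. f w s}))"
    "codeword_entropy M f B = entropy {..<M} (\<lambda>w. ({s \<in> B. f w s}, {s \<in> A. f w s}))"
    "codeword_entropy M f (insert t A) = entropy {..<M} (\<lambda>w. (f w t, {s \<in> A. f w s}))"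
    unfolding codeword_entropy_def using AB by (intro entropy_cong; blast)+
  with entropy_submodular[of "{..<M}" "\<lambda>w. f w t" "\<lambda>w. {s \<in> B. f w s}" "\<lambda>w. {s \<in> A. f w s}"]
  show "codeword_entropy M f (insert t B) - codeword_entropy M f B
      \<le> codeword_entropy M f (insert t A) - codeword_entropy M f A"
    by (simp add: codeword_entropy_def)
qed

lemma entropy_subset_le_card:
  assumes "finite \<Omega>" "finite A" "\<And>\<omega>. X \<omega> \<subseteq> A"
  shows "entropy \<Omega> X \<le> card A"
  using entropy_le_log_card[OF assms(1), of "Pow A" X] assms(2,3)
  by (auto simp: card_Pow log_nat_power)

lemma codeword_entropy_le_card: "finite A \<Longrightarrow> codeword_entropy M f A \<le> card A"
  unfolding codeword_entropy_def by (rule entropy_subset_le_card) auto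

section \<open>Entropy of the received sequence\<close>

text \<open>\<open>direct\<close> and \<open>cross\<close> are G11 and G21, the two gains seen by
  receiver 1. Receiver 2 is reached later by exchanging the users.\<close>

definition direct :: "gains \<Rightarrow> bool" where "direct g = fst g"
definition cross :: "gains \<Rightarrow> bool" where "cross g = fst (snd (snd g))"

lemma length_obs1: "length (obs1 x1 x2 gs) = length gs"
  by (simp add: obs1_def)

lemma nth_obs1:
  "t < length gs \<Longrightarrow> obs1 x1 x2 gs ! t =
    ((direct (gs ! t) \<and> x1 t) \<noteq> (cross (gs ! t) \<and> x2 t), direct (gs ! t), cross (gs ! t))"
  by (cases "gs ! t") (simp add: obs1_def direct_def cross_def)

lemma obs1_eq_iff:
  "obs1 x1 x2 gs = obs1 y1 y2 gs \<longleftrightarrow>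
    (\<forall>t<length gs. ((direct (gs ! t) \<and> x1 t) \<noteq> (cross (gs ! t) \<and> x2 t)) =
      ((direct (gs ! t) \<and> y1 t) \<noteq> (cross (gs ! t) \<and> y2 t)))"
  by (simp add: list_eq_iff_nth_eq length_obs1 nth_obs1)

text \<open>The gain realisation is frozen here, so the output is a deterministic function of the
  uniform message pair; averaging over gains comes afterwards.\<close>

context
  fixes M1 M2 :: nat and f1 f2 :: "nat \<Rightarrow> nat \<Rightarrow> bool" and gs :: "gains list"
    and \<Omega> Y Dir Cross
  defines "\<Omega> \<equiv> {..<M1} \<times> {..<M2}"
    and "Y \<equiv> \<lambda>\<omega>. obs1 (f1 (fst \<omega>)) (f2 (snd \<omega>)) gs"
    and "Dir \<equiv> {t. t < length gs \<and> direct (gs ! t)}"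
    and "Cross \<equiv> {t. t < length gs \<and> cross (gs ! t)}"
  assumes M: "0 < M1" "0 < M2"
begin

lemma finite_Omega: "finite \<Omega>" by (simp add: \<Omega>_def)

lemma finite_positions: "finite Dir" "finite Cross"
  by (simp_all add: Dir_def Cross_def)

lemma entropy_codeword1: "entropy \<Omega> (\<lambda>\<omega>. {t \<in> A. f1 (fst \<omega>) t}) = codeword_entropy M1 f1 A"
  unfolding \<Omega>_def codeword_entropy_def
  using M entropy_fst[of "{..<M1}" "{..<M2}" "\<lambda>w. {t \<in> A. f1 w t}"] by auto

lemma entropy_codeword2: "entropy \<Omega> (\<lambda>\<omega>. {t \<in> A. f2 (snd \<omega>) t}) = codeword_entropy M2 f2 A"
  unfolding \<Omega>_def codeword_entropy_def
  using M entropy_snd[of "{..<M1}" "{..<M2}" "\<lambda>w. {t \<in> A. f2 w t}"] by auto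

text \<open>Knowing \<open>W1\<close>, receiver 1 can cancel its own signal and read the
  interferer's bits wherever the cross gain is on. Hence the pair of \<open>W1\<close> and output
  has entropy at least \<open>log 2 M1\<close> plus the interference entropy, and Fano's inequality
  bounds what the output alone can miss.\<close>

lemma decoding_bound:
  "log 2 M1 * (1 - card {\<omega>\<in>\<Omega>. \<phi> (Y \<omega>) \<noteq> fst \<omega>} / card \<Omega>) - 1
    \<le> entropy \<Omega> Y - codeword_entropy M2 f2 Cross"
proof -
  have "entropy \<Omega> (\<lambda>\<omega>. (fst \<omega>, Y \<omega>)) - entropy \<Omega> Y
    \<le> 1 + card {\<omega>\<in>\<Omega>. \<phi> (Y \<omega>) \<noteq> fst \<omega>} / card \<Omega> * log 2 M1"
    using M by (intro entropy_fano finite_Omega) (auto simp: \<Omega>_def)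
  moreover have "entropy \<Omega> (\<lambda>\<omega>. (fst \<omega>, {t \<in> Cross. f2 (snd \<omega>) t})) \<le> entropy \<Omega> (\<lambda>\<omega>. (fst \<omega>, Y \<omega>))"
    by (intro entropy_mono finite_Omega) (auto simp: Y_def Cross_def obs1_eq_iff)
  moreover have "entropy \<Omega> (\<lambda>\<omega>. (fst \<omega>, {t \<in> Cross. f2 (snd \<omega>) t}))
      = log 2 M1 + codeword_entropy M2 f2 Cross"
    unfolding \<Omega>_def codeword_entropy_def
    using M entropy_product[of "{..<M1}" "{..<M2}" "\<lambda>w. w" "\<lambda>w. {t \<in> Cross. f2 w t}"]
      entropy_inj_on[of "{..<M1}" "\<lambda>w. w"] by auto
  ultimately show ?thesis by (simp add: algebra_simps)
qed

lemma entropy_output_le_direct: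
  "entropy \<Omega> Y \<le> codeword_entropy M1 f1 Dir + codeword_entropy M2 f2 Cross"
proof -
  have "entropy \<Omega> Y \<le> entropy \<Omega> (\<lambda>\<omega>. ({t \<in> Dir. f1 (fst \<omega>) t}, {t \<in> Cross. f2 (snd \<omega>) t}))"
    by (intro entropy_mono finite_Omega)
       (simp add: Y_def Cross_def Dir_def obs1_eq_iff set_eq_iff, blast)
  also have "\<dots> \<le> codeword_entropy M1 f1 Dir + codeword_entropy M2 f2 Cross"
    using entropy_subadditive[OF finite_Omega] by (simp add: entropy_codeword1[symmetric] entropy_codeword2[symmetric])
  finally show ?thesis .
qed

text \<open>Each position with direct gain on yields at most one bit, whatever is received there;
  the other positions show interference only.\<close>

lemma entropy_output_le_card:
  "entropy \<Omega> Y \<le> card Dir + codeword_entropy M2 f2 (Cross - Dir)"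
proof -
  let ?V = "\<lambda>\<omega>. {t \<in> Dir. f1 (fst \<omega>) t \<noteq> (t \<in> Cross \<and> f2 (snd \<omega>) t)}"
  have "entropy \<Omega> Y \<le> entropy \<Omega> (\<lambda>\<omega>. (?V \<omega>, {t \<in> Cross - Dir. f2 (snd \<omega>) t}))"
    by (intro entropy_mono finite_Omega)
       (simp add: Y_def Cross_def Dir_def obs1_eq_iff set_eq_iff, blast)
  also have "\<dots> \<le> entropy \<Omega> ?V + codeword_entropy M2 f2 (Cross - Dir)"
    unfolding entropy_codeword2[symmetric] by (rule entropy_subadditive[OF finite_Omega])
  also have "entropy \<Omega> ?V \<le> card Dir"
    by (intro entropy_subset_le_card finite_Omega finite_positions) auto
  finally show ?thesis by simp
qed

text \<open>Only collisions are charged a full bit per position; the clean positions are charged the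
  entropy of the single signal heard there.\<close>

lemma entropy_output_le_split:
  "entropy \<Omega> Y \<le> codeword_entropy M1 f1 (Dir - Cross) + codeword_entropy M2 f2 (Cross - Dir)
    + card (Dir \<inter> Cross)"
proof -
  let ?V = "\<lambda>\<omega>. {t \<in> Dir \<inter> Cross. f1 (fst \<omega>) t \<noteq> f2 (snd \<omega>) t}"
  let ?X1 = "\<lambda>\<omega>. {t \<in> Dir - Cross. f1 (fst \<omega>) t}"
  let ?X2 = "\<lambda>\<omega>. {t \<in> Cross - Dir. f2 (snd \<omega>) t}"
  have "entropy \<Omega> Y \<le> entropy \<Omega> (\<lambda>\<omega>. (?V \<omega>, ?X1 \<omega>, ?X2 \<omega>))"
    by (intro entropy_mono finite_Omega)
       (simp add: Y_def Cross_def Dir_def obs1_eq_iff set_eq_iff, blast)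
  also have "\<dots> \<le> entropy \<Omega> ?V + entropy \<Omega> (\<lambda>\<omega>. (?X1 \<omega>, ?X2 \<omega>))"
    by (rule entropy_subadditive[OF finite_Omega])
  also have "entropy \<Omega> (\<lambda>\<omega>. (?X1 \<omega>, ?X2 \<omega>))
      \<le> codeword_entropy M1 f1 (Dir - Cross) + codeword_entropy M2 f2 (Cross - Dir)"
    unfolding entropy_codeword1[symmetric] entropy_codeword2[symmetric]
    by (rule entropy_subadditive[OF finite_Omega])
  also have "entropy \<Omega> ?V \<le> card (Dir \<inter> Cross)"
    using finite_positions by (intro entropy_subset_le_card finite_Omega) auto
  finally show ?thesis by simp
qed

end

section \<open>Averaging over the channel gains\<close>

definition gains_expectation :: "real \<Rightarrow> real \<Rightarrow> nat \<Rightarrow> (gains list \<Rightarrow> real) \<Rightarrow> real" where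
  "gains_expectation pd pc n F = (\<Sum>gs\<in>{gs. length gs = n}. seq_prob pd pc gs * F gs)"

lemma sum_gains:
  "(\<Sum>g\<in>UNIV. F g) = (\<Sum>a\<in>UNIV. \<Sum>b\<in>UNIV. \<Sum>c\<in>UNIV. \<Sum>d\<in>UNIV. F (a, b, c, d))"
  for F :: "gains \<Rightarrow> real"
  by (simp add: UNIV_Times_UNIV[symmetric] sum.cartesian_product split_beta del: UNIV_Times_UNIV UNIV_bool)

lemma sum_gain_prob: "(\<Sum>g\<in>UNIV. gain_prob pd pc g) = 1"
  by (simp add: sum_gains gain_prob_def bern_def UNIV_bool algebra_simps)

text \<open>The new symbol is appended at the end, so earlier symbols keep their index and the
  recursion matches that of \<open>thinning\<close>.\<close>

lemma gains_expectation_Suc: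
  "gains_expectation pd pc (Suc n) F
    = gains_expectation pd pc n (\<lambda>gs. \<Sum>g\<in>UNIV. gain_prob pd pc g * F (gs @ [g]))"
proof -
  let ?L = "{gs :: gains list. length gs = n}"
  let ?app = "\<lambda>(gs, g). gs @ [g]"
  have img: "{gs :: gains list. length gs = Suc n} = ?app ` (?L \<times> UNIV)"
    by (auto simp: image_iff length_Suc_conv_rev)
  have "gains_expectation pd pc (Suc n) F
      = (\<Sum>(gs, g)\<in>?L \<times> UNIV. seq_prob pd pc (gs @ [g]) * F (gs @ [g]))"
    unfolding gains_expectation_def img
    by (subst sum.reindex) (auto simp: inj_on_def split_beta)
  also have "\<dots> = (\<Sum>gs\<in>?L. \<Sum>g\<in>UNIV. seq_prob pd pc (gs @ [g]) * F (gs @ [g]))"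
    by (rule sum.cartesian_product[symmetric])
  finally show ?thesis
    by (simp add: gains_expectation_def seq_prob_def sum_distrib_left mult.assoc)
qed

lemma gains_expectation_linear:
  "gains_expectation pd pc n (\<lambda>gs. a * F gs + b * G gs)
    = a * gains_expectation pd pc n F + b * gains_expectation pd pc n G"
  by (simp add: gains_expectation_def sum_distrib_left sum.distrib algebra_simps)

lemma gains_expectation_add:
  "gains_expectation pd pc n (\<lambda>gs. F gs + G gs)
    = gains_expectation pd pc n F + gains_expectation pd pc n G"
  using gains_expectation_linear[of pd pc n 1 F 1 G] by simp

lemma gains_expectation_diff:
  "gains_expectation pd pc n (\<lambda>gs. F gs - G gs)
    = gains_expectation pd pc n F - gains_expectation pd pc n G"
  using gains_expectation_linear[of pd pc n 1 F "-1" G] by simp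

lemma gains_expectation_cmult:
  "gains_expectation pd pc n (\<lambda>gs. c * F gs) = c * gains_expectation pd pc n F"
  using gains_expectation_linear[of pd pc n c F 0 F] by simp

lemma gains_expectation_const: "gains_expectation pd pc n (\<lambda>_. c) = c"
  by (induction n)
     (simp_all add: gains_expectation_Suc sum_gain_prob sum_distrib_right[symmetric],
      simp add: gains_expectation_def seq_prob_def)

lemma gains_expectation_cong:
  "(\<And>gs. length gs = n \<Longrightarrow> F gs = G gs) \<Longrightarrow> gains_expectation pd pc n F = gains_expectation pd pc n G"
  by (simp add: gains_expectation_def)

lemma gains_expectation_mono:
  assumes "0 \<le> pd" "pd \<le> 1" "0 \<le> pc" "pc \<le> 1" "\<And>gs. length gs = n \<Longrightarrow> F gs \<le> G gs"
  shows "gains_expectation pd pc n F \<le> gains_expectation pd pc n G"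
proof -
  have "0 \<le> gain_prob pd pc g" for g
    using assms(1-4) by (cases g) (simp add: gain_prob_def bern_def)
  then have "0 \<le> seq_prob pd pc gs" for gs
    unfolding seq_prob_def by (intro prod_list_nonneg) auto
  then show ?thesis
    unfolding gains_expectation_def using assms(5) by (intro sum_mono mult_left_mono) auto
qed

text \<open>Gain symbols are independent over time, so the positions where an event occurs form a
  random subset whose keeping probability is that of the event.\<close>

lemma gains_expectation_positions:
  "gains_expectation pd pc n (\<lambda>gs. F {t. t < n \<and> Q (gs ! t)})
    = thinning (\<Sum>g | Q g. gain_prob pd pc g) n F"
proof (induction n arbitrary: F)
  case 0
  then show ?case by (simp add: gains_expectation_const)
next
  case (Suc n)
  define p where "p = (\<Sum>g | Q g. gain_prob pd pc g)"
  have split: "(\<Sum>g\<in>UNIV. gain_prob pd pc g * (if Q g then x else y)) = p * x + (1 - p) * y" for x y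
  proof -
    have "(\<Sum>g | \<not> Q g. gain_prob pd pc g) = 1 - p"
      using sum_gain_prob[of pd pc]
        sum.union_disjoint[of "{g. Q g}" "{g. \<not> Q g}" "gain_prob pd pc"]
      by (simp add: p_def disjoint_iff Collect_disj_eq[symmetric])
    then show ?thesis
      by (simp add: if_distrib sum.If_cases sum_distrib_right[symmetric] p_def Compl_eq)
  qed
  have "gains_expectation pd pc (Suc n) (\<lambda>gs. F {t. t < Suc n \<and> Q (gs ! t)})
     = gains_expectation pd pc n (\<lambda>gs. p * F (insert n {t. t < n \<and> Q (gs ! t)})
         + (1 - p) * F {t. t < n \<and> Q (gs ! t)})"
    unfolding gains_expectation_Suc
  proof (rule gains_expectation_cong)
    fix gs :: "gains list" assume len: "length gs = n"
    have "{t. t < Suc n \<and> Q ((gs @ [g]) ! t)}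
        = (if Q g then insert n {t. t < n \<and> Q (gs ! t)} else {t. t < n \<and> Q (gs ! t)})" for g
      using len by (auto simp: nth_append less_Suc_eq)
    then have "(\<Sum>g\<in>UNIV. gain_prob pd pc g * F {t. t < Suc n \<and> Q ((gs @ [g]) ! t)})
        = (\<Sum>g\<in>UNIV. gain_prob pd pc g * (if Q g then F (insert n {t. t < n \<and> Q (gs ! t)})
             else F {t. t < n \<and> Q (gs ! t)}))"
      by (intro sum.cong) auto
    then show "(\<Sum>g\<in>UNIV. gain_prob pd pc g * F {t. t < Suc n \<and> Q ((gs @ [g]) ! t)})
        = p * F (insert n {t. t < n \<and> Q (gs ! t)}) + (1 - p) * F {t. t < n \<and> Q (gs ! t)}"
      by (simp only: split)
  qed
  also have "\<dots> = thinning p (Suc n) F"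
    using Suc.IH[of "\<lambda>A. F (insert n A)"] Suc.IH[of F]
    by (simp add: gains_expectation_linear p_def)
  finally show ?case by (simp add: p_def)
qed

lemma gain_prob_events:
  "(\<Sum>g | direct g. gain_prob pd pc g) = pd"
  "(\<Sum>g | cross g. gain_prob pd pc g) = pc"
  "(\<Sum>g | direct g \<and> \<not> cross g. gain_prob pd pc g) = pd * (1 - pc)"
  "(\<Sum>g | cross g \<and> \<not> direct g. gain_prob pd pc g) = pc * (1 - pd)"
  "(\<Sum>g | direct g \<and> cross g. gain_prob pd pc g) = pd * pc"
proof -
  have "(\<Sum>g | Q g. gain_prob pd pc g) = (\<Sum>g\<in>UNIV. if Q g then gain_prob pd pc g else 0)" for Q
    by (simp add: sum.If_cases)
  then show "(\<Sum>g | direct g. gain_prob pd pc g) = pd"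
    "(\<Sum>g | cross g. gain_prob pd pc g) = pc"
    "(\<Sum>g | direct g \<and> \<not> cross g. gain_prob pd pc g) = pd * (1 - pc)"
    "(\<Sum>g | cross g \<and> \<not> direct g. gain_prob pd pc g) = pc * (1 - pd)"
    "(\<Sum>g | direct g \<and> cross g. gain_prob pd pc g) = pd * pc"
    by (simp_all add: sum_gains UNIV_bool direct_def cross_def gain_prob_def bern_def)
       (simp_all add: algebra_simps)
qed

section \<open>Error probability and the symmetry between the users\<close>

lemma err1_eq_expectation:
  "err1 pd pc n M1 M2 f1 f2 \<phi> = gains_expectation pd pc n (\<lambda>gs.
     card {\<omega> \<in> {..<M1} \<times> {..<M2}. \<phi> (obs1 (f1 (fst \<omega>)) (f2 (snd \<omega>)) gs) \<noteq> fst \<omega>}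
     / card ({..<M1} \<times> {..<M2}))"
proof -
  let ?L = "{gs :: gains list. length gs = n}"
  let ?e = "\<lambda>w1 w2 gs. if \<phi> (obs1 (f1 w1) (f2 w2) gs) \<noteq> w1 then 1 else 0 :: real"
  have "err1 pd pc n M1 M2 f1 f2 \<phi>
      = (\<Sum>gs\<in>?L. \<Sum>w1<M1. \<Sum>w2<M2. seq_prob pd pc gs / (real M1 * real M2) * ?e w1 w2 gs)"
    unfolding err1_def by (subst (2) sum.swap, subst sum.swap, rule refl)
  also have "\<dots> = (\<Sum>gs\<in>?L. seq_prob pd pc gs * ((\<Sum>w1<M1. \<Sum>w2<M2. ?e w1 w2 gs) / (real M1 * real M2)))"
    by (simp add: sum_distrib_left sum_divide_distrib)
  also have "(\<lambda>gs. \<Sum>w1<M1. \<Sum>w2<M2. ?e w1 w2 gs) = (\<lambda>gs. real (card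
      {\<omega> \<in> {..<M1} \<times> {..<M2}. \<phi> (obs1 (f1 (fst \<omega>)) (f2 (snd \<omega>)) gs) \<noteq> fst \<omega>}))"
    unfolding sum.cartesian_product split_beta
    by (subst sum.inter_filter[symmetric]) simp_all
  finally show ?thesis
    by (simp add: gains_expectation_def card_cartesian_product)
qed

lemma err1_le_1:
  assumes "0 \<le> pd" "pd \<le> 1" "0 \<le> pc" "pc \<le> 1"
  shows "err1 pd pc n M1 M2 f1 f2 \<phi> \<le> 1"
proof -
  \<comment> \<open>The case \<open>b = 0\<close> covers an empty message set, where the quotient is
    0 by convention.\<close>
  have frac: "real a / real b \<le> 1" if "a \<le> b" for a b
    using that by (cases "b = 0") (auto simp: divide_le_eq_1)
  have "err1 pd pc n M1 M2 f1 f2 \<phi> \<le> gains_expectation pd pc n (\<lambda>_. 1)"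
    unfolding err1_eq_expectation
  proof (rule gains_expectation_mono[OF assms])
    fix gs :: "gains list"
    show "real (card {\<omega> \<in> {..<M1} \<times> {..<M2}. \<phi> (obs1 (f1 (fst \<omega>)) (f2 (snd \<omega>)) gs) \<noteq> fst \<omega>})
      / real (card ({..<M1} \<times> {..<M2})) \<le> 1"
      by (intro frac card_mono) auto
  qed
  then show ?thesis by (simp add: gains_expectation_const)
qed

lemma err2_eq_err1: "err2 pd pc n M1 M2 f1 f2 \<phi> = err1 pd pc n M2 M1 f2 f1 \<phi>"
proof -
  \<comment> \<open>Exchanging the user indices sends (G11, G12, G21, G22) to (G22, G21, G12, G11).
    This involution preserves probabilities and turns the view of receiver 2 into that of receiver
    1.\<close>
  define sw :: "gains \<Rightarrow> gains" where "sw = (\<lambda>(a, b, c, d). (d, c, b, a))"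
  have sw2: "sw (sw g) = g" for g by (cases g) (simp add: sw_def)
  have msw2: "map sw (map sw gs) = gs" for gs
    by (simp add: sw2 comp_def)
  have prob: "seq_prob pd pc (map sw gs) = seq_prob pd pc gs" for gs
    by (induction gs) (auto simp: seq_prob_def sw_def gain_prob_def split: prod.splits)
  have obs: "obs2 x1 x2 (map sw gs) = obs1 x2 x1 gs" for x1 x2 gs
    by (rule nth_equalityI) (auto simp: obs1_def obs2_def sw_def split: prod.splits)
  have "(\<Sum>gs\<in>{gs. length gs = n}. seq_prob pd pc gs / (real M1 * real M2) *
        (if \<phi> (obs2 (f1 w1) (f2 w2) gs) \<noteq> w2 then 1 else 0))
      = (\<Sum>gs\<in>{gs. length gs = n}. seq_prob pd pc gs / (real M2 * real M1) *
        (if \<phi> (obs1 (f2 w2) (f1 w1) gs) \<noteq> w2 then 1 else 0))" for w1 w2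
    by (rule sum.reindex_bij_witness[of _ "map sw" "map sw"])
       (simp_all only: mem_Collect_eq length_map msw2 prob obs[symmetric] mult.commute[of "real M1"])
  then show ?thesis
    unfolding err1_def err2_def by (subst sum.swap) simp
qed

text \<open>Averages the bounds for a fixed gain realisation over the gains; each position set
  becomes a thinning with the probability of its event.\<close>

lemma receiver1_bounds:
  fixes f1 f2 :: "nat \<Rightarrow> nat \<Rightarrow> bool" and \<phi> :: "(bool \<times> bool \<times> bool) list \<Rightarrow> nat" and n :: nat
  assumes p: "0 \<le> pd" "pd \<le> 1" "0 \<le> pc" "pc \<le> 1" and M: "0 < M1" "0 < M2"
  defines "H1 \<equiv> codeword_entropy M1 f1" and "H2 \<equiv> codeword_entropy M2 f2"
    and "L \<equiv> log 2 M1 * (1 - err1 pd pc n M1 M2 f1 f2 \<phi>) - 1"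
  shows "L \<le> thinning pd n H1"
    and "L \<le> pd * n + thinning (pc * (1 - pd)) n H2 - thinning pc n H2"
    and "L \<le> thinning (pd * (1 - pc)) n H1 + thinning (pc * (1 - pd)) n H2 + pd * pc * n
              - thinning pc n H2"
proof -
  let ?Dir = "\<lambda>gs. {t. t < n \<and> direct (gs ! t)}"
  let ?Cross = "\<lambda>gs. {t. t < n \<and> cross (gs ! t)}"
  let ?E = "\<lambda>gs. entropy ({..<M1} \<times> {..<M2}) (\<lambda>\<omega>. obs1 (f1 (fst \<omega>)) (f2 (snd \<omega>)) gs)"
  have minus: "?Dir gs - ?Cross gs = {t. t < n \<and> (direct (gs ! t) \<and> \<not> cross (gs ! t))}"
    "?Cross gs - ?Dir gs = {t. t < n \<and> (cross (gs ! t) \<and> \<not> direct (gs ! t))}"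
    "?Dir gs \<inter> ?Cross gs = {t. t < n \<and> (direct (gs ! t) \<and> cross (gs ! t))}" for gs :: "gains list"
    by auto
  have thin: "gains_expectation pd pc n (\<lambda>gs. F (?Dir gs)) = thinning pd n F"
    "gains_expectation pd pc n (\<lambda>gs. F (?Cross gs)) = thinning pc n F"
    "gains_expectation pd pc n (\<lambda>gs. F (?Dir gs - ?Cross gs)) = thinning (pd * (1 - pc)) n F"
    "gains_expectation pd pc n (\<lambda>gs. F (?Cross gs - ?Dir gs)) = thinning (pc * (1 - pd)) n F"
    "gains_expectation pd pc n (\<lambda>gs. F (?Dir gs \<inter> ?Cross gs)) = thinning (pd * pc) n F" for F
    unfolding minus
    using gains_expectation_positions[of pd pc n F direct]
      gains_expectation_positions[of pd pc n F cross]
      gains_expectation_positions[of pd pc n F "\<lambda>g. direct g \<and> \<not> cross g"]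
      gains_expectation_positions[of pd pc n F "\<lambda>g. cross g \<and> \<not> direct g"]
      gains_expectation_positions[of pd pc n F "\<lambda>g. direct g \<and> cross g"]
    by (simp_all only: gain_prob_events)
  have "L = gains_expectation pd pc n (\<lambda>gs. log 2 M1 *
     (1 - card {\<omega> \<in> {..<M1} \<times> {..<M2}. \<phi> (obs1 (f1 (fst \<omega>)) (f2 (snd \<omega>)) gs) \<noteq> fst \<omega>}
     / card ({..<M1} \<times> {..<M2})) - 1)"
    unfolding L_def err1_eq_expectation
    by (simp only: gains_expectation_diff gains_expectation_cmult gains_expectation_const)
  also have "\<dots> \<le> gains_expectation pd pc n (\<lambda>gs. ?E gs - H2 (?Cross gs))"
    unfolding H2_def
  proof (rule gains_expectation_mono[OF p])
    fix gs :: "gains list" assume "length gs = n"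
    then show "log 2 M1 *
       (1 - card {\<omega> \<in> {..<M1} \<times> {..<M2}. \<phi> (obs1 (f1 (fst \<omega>)) (f2 (snd \<omega>)) gs) \<noteq> fst \<omega>}
       / card ({..<M1} \<times> {..<M2})) - 1 \<le> ?E gs - codeword_entropy M2 f2 (?Cross gs)"
      using decoding_bound[OF M, where gs = gs and \<phi> = \<phi> and ?f1.0 = f1 and ?f2.0 = f2] by simp
  qed
  also have "\<dots> = gains_expectation pd pc n ?E - thinning pc n H2"
    by (simp only: gains_expectation_diff thin)
  finally have L: "L \<le> gains_expectation pd pc n ?E - thinning pc n H2" .
  have received: "?E gs \<le> H1 (?Dir gs) + H2 (?Cross gs)"
    "?E gs \<le> real (card (?Dir gs)) + H2 (?Cross gs - ?Dir gs)"
    "?E gs \<le> H1 (?Dir gs - ?Cross gs) + H2 (?Cross gs - ?Dir gs) + real (card (?Dir gs \<inter> ?Cross gs))"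
    if "length gs = n" for gs
    using entropy_output_le_direct[OF M, where gs = gs and ?f1.0 = f1 and ?f2.0 = f2]
      entropy_output_le_card[OF M, where gs = gs and ?f1.0 = f1 and ?f2.0 = f2]
      entropy_output_le_split[OF M, where gs = gs and ?f1.0 = f1 and ?f2.0 = f2]
    unfolding that H1_def H2_def by blast+
  have "gains_expectation pd pc n ?E \<le> gains_expectation pd pc n (\<lambda>gs. H1 (?Dir gs) + H2 (?Cross gs))"
    by (intro gains_expectation_mono p received(1))
  \<comment> \<open>The interference term \<open>H2 (?Cross gs)\<close> averages to
    \<open>thinning pc n H2\<close>, which cancels against the one subtracted in
    \<open>L\<close>.\<close>
  with L show "L \<le> thinning pd n H1" by (simp add: gains_expectation_add thin)
  have "gains_expectation pd pc n ?E
      \<le> gains_expectation pd pc n (\<lambda>gs. real (card (?Dir gs)) + H2 (?Cross gs - ?Dir gs))"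
    by (intro gains_expectation_mono p received(2))
  also have "\<dots> = pd * n + thinning (pc * (1 - pd)) n H2"
    by (simp only: gains_expectation_add thin(4) thin(1)[of "\<lambda>A. real (card A)"] thinning_card)
  finally show "L \<le> pd * n + thinning (pc * (1 - pd)) n H2 - thinning pc n H2"
    using L by simp
  have "gains_expectation pd pc n ?E \<le> gains_expectation pd pc n (\<lambda>gs. H1 (?Dir gs - ?Cross gs)
      + H2 (?Cross gs - ?Dir gs) + real (card (?Dir gs \<inter> ?Cross gs)))"
    by (intro gains_expectation_mono p received(3))
  also have "\<dots> = thinning (pd * (1 - pc)) n H1 + thinning (pc * (1 - pd)) n H2 + pd * pc * n"
    by (simp only: gains_expectation_add thin(3,4) thin(5)[of "\<lambda>A. real (card A)"] thinning_card)
  finally show "L \<le> thinning (pd * (1 - pc)) n H1 + thinning (pc * (1 - pd)) n H2 + pd * pc * n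
              - thinning pc n H2"
    using L by simp
qed


section \<open>Outer bounds\<close>

text \<open>The features of a normalised thinned codeword entropy that the outer bounds use. Past
  this point the code disappears and each face is an inequality between real functions.\<close>

definition erasure_profile :: "(real \<Rightarrow> real) \<Rightarrow> bool" where
  "erasure_profile h \<longleftrightarrow>
     (\<forall>p. 0 \<le> p \<and> p \<le> 1 \<longrightarrow> 0 \<le> h p \<and> h p \<le> p) \<and>
     (\<forall>p q. 0 \<le> p \<and> p \<le> q \<and> q \<le> 1 \<longrightarrow> h p \<le> h q) \<and>
     (\<forall>p q l. 0 \<le> p \<and> p \<le> q \<and> q \<le> 1 \<and> 0 \<le> l \<and> l \<le> 1 \<longrightarrow>
        (1 - l) * h p + l * h q \<le> h ((1 - l) * p + l * q))"

lemma erasure_profile_concave: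
  "erasure_profile h \<Longrightarrow> 0 \<le> p \<Longrightarrow> p \<le> q \<Longrightarrow> q \<le> 1 \<Longrightarrow> 0 \<le> l \<Longrightarrow> l \<le> 1 \<Longrightarrow>
    (1 - l) * h p + l * h q \<le> h ((1 - l) * p + l * q)"
  unfolding erasure_profile_def by blast

lemma erasure_profile_codeword:
  assumes n: "0 < n"
  shows "erasure_profile (\<lambda>p. thinning p n (codeword_entropy M f) / n)"
  unfolding erasure_profile_def
proof (intro conjI allI impI; elim conjE)
  fix p q l :: real
  let ?T = "\<lambda>p. thinning p n (codeword_entropy M f)"
  show "?T p / n \<le> ?T q / n" if "0 \<le> p" "p \<le> q" "q \<le> 1"
    using that by (intro divide_right_mono thinning_mono_prob mono_codeword_entropy) auto
  show "(1 - l) * (?T p / n) + l * (?T q / n) \<le> ?T ((1 - l) * p + l * q) / n"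
    if "0 \<le> p" "p \<le> q" "q \<le> 1" "0 \<le> l" "l \<le> 1"
    using divide_right_mono[OF thinning_concave[OF that antimono_codeword_entropy_increment, of n M f], of n]
    by (simp add: add_divide_distrib)
  assume p: "0 \<le> p" "p \<le> 1"
  have "?T p \<le> thinning p n (\<lambda>A. real (card A))"
    using p by (intro thinning_mono codeword_entropy_le_card) (auto intro: finite_subset)
  then show "?T p / n \<le> p" using n by (simp add: thinning_card divide_le_eq)
  have "thinning p n (\<lambda>_. 0) \<le> ?T p"
    using p by (intro thinning_mono) (auto simp: codeword_entropy_def entropy_nonneg)
  then show "0 \<le> ?T p / n" by (simp add: thinning_const)
qed

text \<open>Here \<open>u\<close> stands for the rate of the user with profile \<open>h\<close>, and
  \<open>h'\<close> is the interferer's profile.\<close>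

definition receiver_bounds ::
    "real \<Rightarrow> real \<Rightarrow> (real \<Rightarrow> real) \<Rightarrow> (real \<Rightarrow> real) \<Rightarrow> real \<Rightarrow> bool" where
  "receiver_bounds pd pc h h' u \<longleftrightarrow>
     u \<le> h pd \<and>
     u \<le> pd + h' (pc * (1 - pd)) - h' pc \<and>
     u \<le> h (pd * (1 - pc)) + h' (pc * (1 - pd)) + pd * pc - h' pc"

lemma receiver_bounds_code:
  fixes R1 R2 :: real
  assumes p: "0 \<le> pd" "pd \<le> 1" "0 \<le> pc" "pc \<le> 1" and n: "0 < n"
  defines "M1 \<equiv> num_msgs n R1" and "M2 \<equiv> num_msgs n R2"
  shows "receiver_bounds pd pc (\<lambda>p. thinning p n (codeword_entropy M1 f1) / n)
    (\<lambda>p. thinning p n (codeword_entropy M2 f2) / n)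
    (R1 * (1 - err1 pd pc n M1 M2 f1 f2 \<phi>) - 1 / n)"
proof -
  let ?e = "err1 pd pc n M1 M2 f1 f2 \<phi>"
  have ge: "2 powr (real n * R) \<le> num_msgs n R" for R
    unfolding num_msgs_def by (rule order.trans[OF le_of_int_ceiling]) (simp add: of_nat_nat)
  have M: "0 < M1" "0 < M2"
    using order.strict_trans2[OF _ ge, of 0] by (auto simp: M1_def M2_def)
  have "log 2 (2 powr (real n * R1)) \<le> log 2 M1"
    using ge by (intro log_mono) (auto simp: M1_def)
  then have "real n * R1 \<le> log 2 M1" by simp
  \<comment> \<open>The factor \<open>1 - ?e\<close> is nonnegative, so the rounding up in
    \<open>num_msgs\<close> works in the right direction.\<close>
  then have "real n * R1 * (1 - ?e) \<le> log 2 M1 * (1 - ?e)"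
    using err1_le_1[OF p] by (intro mult_right_mono) auto
  then have u: "real n * (R1 * (1 - ?e) - 1 / n) \<le> log 2 M1 * (1 - ?e) - 1"
    using n by (simp add: right_diff_distrib)
  have scale: "x \<le> y / n" if "real n * x \<le> y" for x y
    using that n by (simp add: field_simps)
  show ?thesis
    unfolding receiver_bounds_def
    using scale[OF order.trans[OF u receiver1_bounds(1)[OF p M]]]
      scale[OF order.trans[OF u receiver1_bounds(2)[OF p M]]]
      scale[OF order.trans[OF u receiver1_bounds(3)[OF p M]]] n
    by (simp add: add_divide_distrib diff_divide_distrib)
qed

text \<open>The profiles vary with the block length, but the bound is uniform over all profiles.
  Only the two rate expressions have to converge.\<close>

lemma achievable_halfplane:
  assumes p: "0 \<le> pd" "pd \<le> 1" "0 \<le> pc" "pc \<le> 1" and ach: "achievable pd pc R1 R2"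
    and bound: "\<And>h1 h2 u1 u2. erasure_profile h1 \<Longrightarrow> erasure_profile h2 \<Longrightarrow>
      receiver_bounds pd pc h1 h2 u1 \<Longrightarrow> receiver_bounds pd pc h2 h1 u2 \<Longrightarrow> x * u1 + y * u2 \<le> z"
  shows "x * R1 + y * R2 \<le> z"
proof -
  from ach obtain f1 f2 \<phi>1 \<phi>2 where R: "0 \<le> R1" "0 \<le> R2"
    and e1: "(\<lambda>n. err1 pd pc n (num_msgs n R1) (num_msgs n R2) (f1 n) (f2 n) (\<phi>1 n)) \<longlonglongrightarrow> 0" (is "?e1 \<longlonglongrightarrow> 0")
    and e2: "(\<lambda>n. err1 pd pc n (num_msgs n R2) (num_msgs n R1) (f2 n) (f1 n) (\<phi>2 n)) \<longlonglongrightarrow> 0" (is "?e2 \<longlonglongrightarrow> 0")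
    unfolding achievable_def err2_eq_err1 by blast
  have "(\<lambda>n. x * (R1 * (1 - ?e1 n) - 1 / real n) + y * (R2 * (1 - ?e2 n) - 1 / real n))
      \<longlonglongrightarrow> x * (R1 * (1 - 0) - 0) + y * (R2 * (1 - 0) - 0)"
    by (intro tendsto_intros e1 e2 lim_1_over_n)
  moreover have "x * (R1 * (1 - ?e1 n) - 1 / real n) + y * (R2 * (1 - ?e2 n) - 1 / real n) \<le> z"
    if "1 \<le> n" for n
    using that
    by (intro bound[OF erasure_profile_codeword[of n "num_msgs n R1" "f1 n"]
          erasure_profile_codeword[of n "num_msgs n R2" "f2 n"]] receiver_bounds_code p) auto
  ultimately show ?thesis by (auto intro: LIMSEQ_le_const2)
qed

text \<open>A half-plane is closed, so a linear bound on achievable pairs survives the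
  closure.\<close>

lemma capacity_region_halfplane:
  assumes "(R1, R2) \<in> capacity_region pd pc"
    and "\<And>R1 R2. achievable pd pc R1 R2 \<Longrightarrow> x * R1 + y * R2 \<le> z"
  shows "x * R1 + y * R2 \<le> z"
proof -
  let ?H = "{r :: real \<times> real. x * fst r + y * snd r \<le> z}"
  have "closed ?H" by (intro closed_Collect_le continuous_intros)
  moreover have "{(R1, R2). achievable pd pc R1 R2} \<subseteq> ?H" using assms(2) by auto
  ultimately have "capacity_region pd pc \<subseteq> ?H"
    unfolding capacity_region_def by (intro closure_minimal)
  with assms(1) show ?thesis by auto
qed

section \<open>The faces of the three regions\<close>

lemma weak_interference_bound:
  assumes p: "0 < pd" "pd \<le> 1" "0 < pc" "pc \<le> pd / (1 + pd)"
    and h: "erasure_profile h1" "erasure_profile h2"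
    and u: "receiver_bounds pd pc h1 h2 u1" "receiver_bounds pd pc h2 h1 u2"
  defines "\<beta> \<equiv> (pd - pc) / (pd * pc)"
  shows "u1 + \<beta> * u2 \<le> \<beta> * pd + pc - pd * pc"
proof -
  define a where "a = pd * (1 - pc)"
  define r where "r = pc * (1 - pd)"
  \<comment> \<open>This is \<open>1 / \<beta>\<close>, and also the weight with which
    \<open>pc\<close> lies between \<open>r\<close> and \<open>a\<close>. The interference
    hypothesis gives \<open>l \<le> 1\<close>. The inequality is proved multiplied by
    \<open>l\<close> and rescaled by \<open>\<beta>\<close> at the end.\<close>
  define l where "l = pd * pc / (pd - pc)"
  have le: "pc + pc * pd \<le> pd" using p by (simp add: field_simps)
  have lt: "pc < pd" using le mult_pos_pos[OF p(3,1)] by linarith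
  have l: "0 < l" "l \<le> 1" using lt le p by (auto simp: l_def field_simps)
  have beta: "\<beta> * l = 1" using lt p by (simp add: \<beta>_def l_def field_simps)
  have ldiff: "l * (pd - pc) = pd * pc" using lt by (simp add: l_def)
  have "(1 - l) * r + l * a = r + l * (pd - pc)" by (simp add: a_def r_def algebra_simps)
  then have mix: "(1 - l) * r + l * a = pc" unfolding ldiff by (simp add: r_def algebra_simps)
  have range: "0 \<le> r" "r \<le> a" "a \<le> 1" "r \<le> 1"
    unfolding a_def r_def using p lt by (auto intro!: mult_le_one) (simp add: algebra_simps)
  have conc: "(1 - l) * h r + l * h a \<le> h pc" if "erasure_profile h" for h
    using erasure_profile_concave[OF that range(1-3), of l] l by (simp add: mix)
  have hr: "h1 r \<le> r" "h2 r \<le> r"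
    using h range by (auto simp: erasure_profile_def)
  have "l * u1 \<le> l * (h1 a + h2 r + pd * pc - h2 pc)"
    using u(1) l by (intro mult_left_mono) (auto simp: receiver_bounds_def a_def r_def)
  \<comment> \<open>User 2 is split with weights \<open>1 - l\<^sup>2\<close> and
    \<open>l\<^sup>2\<close> over its second and third bound. Concavity of \<open>h1\<close> then
    leaves \<open>l * h1 r\<close>, and concavity of \<open>h2\<close>, scaled by \<open>l\<close>,
    leaves \<open>l\<^sup>2 * h2 r\<close>.\<close>
  moreover have "(1 - l\<^sup>2) * u2 \<le> (1 - l\<^sup>2) * (pd + h1 r - h1 pc)"
    using u(2) l by (intro mult_left_mono) (auto simp: receiver_bounds_def r_def power_le_one)
  moreover have "l\<^sup>2 * u2 \<le> l\<^sup>2 * (h2 a + h1 r + pd * pc - h1 pc)"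
    using u(2) by (intro mult_left_mono) (auto simp: receiver_bounds_def a_def r_def)
  moreover have "l * ((1 - l) * h2 r + l * h2 a) \<le> l * h2 pc"
    using conc[OF h(2)] l by (intro mult_left_mono) auto
  moreover have "l * h1 r \<le> l * r" "l\<^sup>2 * h2 r \<le> l\<^sup>2 * r"
    using hr l by (auto intro: mult_left_mono)
  \<comment> \<open>This identity makes every remaining quadratic term in \<open>l\<close> cancel,
    leaving \<open>pd + l * r\<close>.\<close>
  moreover have "l * (l * (pd - pc)) = l * (pd * pc)" by (simp only: ldiff)
  then have "l\<^sup>2 * r = l * (pd * pc) * - 1 + l\<^sup>2 * pd - l\<^sup>2 * (pd * pc)"
    by (simp add: r_def algebra_simps power2_eq_square)
  ultimately have "l * u1 + u2 \<le> pd + l * r"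
    using conc[OF h(1)] by (simp add: algebra_simps power2_eq_square)
  then have "\<beta> * (l * u1 + u2) \<le> \<beta> * (pd + l * r)"
    using lt p by (intro mult_left_mono) (auto simp: \<beta>_def)
  then show ?thesis
    using beta by (simp add: distrib_left mult.assoc[symmetric] r_def right_diff_distrib mult.commute[of pc pd])
qed

text \<open>Adds the third bounds of both users. In this regime
  \<open>pd * (1 - pc) \<le> pc\<close>, so monotonicity absorbs each clean-signal term into the
  subtracted interference term.\<close>

lemma moderate_interference_sum_bound:
  assumes p: "0 < pd" "pd \<le> 1" "0 \<le> pc" "pc \<le> 1" "pd / (1 + pd) \<le> pc"
    and h: "erasure_profile h1" "erasure_profile h2"
    and u: "receiver_bounds pd pc h1 h2 u1" "receiver_bounds pd pc h2 h1 u2"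
  shows "u1 + u2 \<le> 2 * pc"
proof -
  have "pd * (1 - pc) \<le> pc" using p by (simp add: field_simps)
  moreover have "0 \<le> pd * (1 - pc)" "0 \<le> pc * (1 - pd)" "pc * (1 - pd) \<le> 1"
    using p by (auto intro: mult_le_one)
  ultimately have "h (pd * (1 - pc)) \<le> h pc" "h (pc * (1 - pd)) \<le> pc * (1 - pd)" if "erasure_profile h" for h
    using that p by (auto simp: erasure_profile_def)
  from this[OF h(1)] this[OF h(2)] show ?thesis
    using u by (simp add: receiver_bounds_def algebra_simps)
qed

text \<open>Concavity on the segment from 0 to \<open>pd\<close> gives
  \<open>h1 pd \<le> (pd / pc) * h1 pc\<close>; the right side is what \<open>pd / pc\<close> times
  the second bound on \<open>u2\<close> subtracts.\<close>

lemma moderate_interference_weighted_bound: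
  assumes p: "0 < pd" "pd \<le> 1" "0 < pc" "pc \<le> pd"
    and h: "erasure_profile h1"
    and u: "receiver_bounds pd pc h1 h2 u1" "receiver_bounds pd pc h2 h1 u2"
  shows "u1 + (pd / pc) * u2 \<le> (pd / pc) * (pd + pc - pd * pc)"
proof -
  have "(1 - pc / pd) * h1 0 + pc / pd * h1 pd \<le> h1 ((1 - pc / pd) * 0 + pc / pd * pd)"
    using p by (intro erasure_profile_concave[OF h]) auto
  moreover have "h1 0 = 0" using h by (auto simp: erasure_profile_def intro: antisym)
  ultimately have "(pc / pd) * h1 pd \<le> h1 pc" using p by simp
  then have "(pd / pc) * ((pc / pd) * h1 pd) \<le> (pd / pc) * h1 pc"
    using p by (intro mult_left_mono) auto
  then have "h1 pd \<le> (pd / pc) * h1 pc" using p by simp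
  moreover have "0 \<le> pc * (1 - pd)" "pc * (1 - pd) \<le> 1" using p by (auto intro: mult_le_one)
  then have "h1 (pc * (1 - pd)) \<le> pc * (1 - pd)" using h by (auto simp: erasure_profile_def)
  then have "u2 \<le> pd + pc - pd * pc - h1 pc"
    using u(2) by (simp add: receiver_bounds_def algebra_simps)
  then have "(pd / pc) * u2 \<le> (pd / pc) * (pd + pc - pd * pc - h1 pc)"
    using p by (intro mult_left_mono) auto
  ultimately show ?thesis
    using u(1) unfolding right_diff_distrib by (simp add: receiver_bounds_def)
qed

text \<open>Since \<open>pd \<le> pc\<close>, the first bound on \<open>u2\<close> is dominated by
  \<open>h2 pc\<close>, which the second bound on \<open>u1\<close> subtracts.\<close>

lemma strong_interference_bound:
  assumes p: "0 \<le> pd" "pc \<le> 1" "pd \<le> pc"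
    and h: "erasure_profile h2"
    and u: "receiver_bounds pd pc h1 h2 u1" "receiver_bounds pd pc h2 h1 u2"
  shows "u1 + u2 \<le> pd + pc - pd * pc"
proof -
  have "h2 pd \<le> h2 pc" using h p by (auto simp: erasure_profile_def)
  moreover have "0 \<le> pc * (1 - pd)" "pc * (1 - pd) \<le> 1" using p by (auto intro: mult_le_one)
  then have "h2 (pc * (1 - pd)) \<le> pc * (1 - pd)" using h by (auto simp: erasure_profile_def)
  ultimately show ?thesis using u by (simp add: receiver_bounds_def algebra_simps)
qed

section \<open>Assembling the regions from half-planes\<close>

theorem theorem2:
  fixes pd pc :: real
  assumes "0 \<le> pd" "pd \<le> 1" "0 \<le> pc" "pc \<le> 1"
  shows "(pc \<le> pd / (1 + pd) \<longrightarrow> capacity_region pd pc \<subseteq> outer1 pd pc) \<and>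
         (pd / (1 + pd) \<le> pc \<and> pc \<le> pd \<longrightarrow> capacity_region pd pc \<subseteq> outer2 pd pc) \<and>
         (pd \<le> pc \<longrightarrow> capacity_region pd pc \<subseteq> outer3 pd pc)"
proof -
  have hp: "x * R1 + y * R2 \<le> z"
    if "(R1, R2) \<in> capacity_region pd pc"
      and "\<And>h1 h2 u1 u2. erasure_profile h1 \<Longrightarrow> erasure_profile h2 \<Longrightarrow>
      receiver_bounds pd pc h1 h2 u1 \<Longrightarrow> receiver_bounds pd pc h2 h1 u2 \<Longrightarrow> x * u1 + y * u2 \<le> z"
    for x y z R1 R2
    by (rule capacity_region_halfplane[OF that(1)], rule achievable_halfplane[OF assms _ that(2)])
  have box: "0 \<le> R1 \<and> R1 \<le> pd \<and> 0 \<le> R2 \<and> R2 \<le> pd" if R: "(R1, R2) \<in> capacity_region pd pc" for R1 R2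
  proof -
    have le: "u \<le> pd" if "erasure_profile h" "receiver_bounds pd pc h h' u" for h h' u
      using that assms by (force simp: erasure_profile_def receiver_bounds_def)
    \<comment> \<open>Nonnegativity is part of achievability and passes to the closure as a
      half-plane.\<close>
    have "-1 * R1 + 0 * R2 \<le> 0" "0 * R1 + -1 * R2 \<le> 0"
      by (rule capacity_region_halfplane[OF R]; simp add: achievable_def)+
    moreover have "1 * R1 + 0 * R2 \<le> pd" "0 * R1 + 1 * R2 \<le> pd"
      by (rule hp[OF R]; simp add: le)+
    ultimately show ?thesis by simp
  qed
  have "capacity_region pd pc \<subseteq> outer1 pd pc" if weak: "pc \<le> pd / (1 + pd)"
  proof (rule subrelI)
    fix R1 R2 assume R: "(R1, R2) \<in> capacity_region pd pc"
    define \<beta> where "\<beta> = (pd - pc) / (pd * pc)"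
    have "R1 + \<beta> * R2 \<le> \<beta> * pd + pc - pd * pc \<and> R2 + \<beta> * R1 \<le> \<beta> * pd + pc - pd * pc"
      if "pd * pc \<noteq> 0"
    proof -
      have pos: "0 < pd" "0 < pc" using that assms by auto
      note bound = weak_interference_bound[OF pos(1) assms(2) pos(2) weak, folded \<beta>_def]
      have "1 * R1 + \<beta> * R2 \<le> \<beta> * pd + pc - pd * pc" "\<beta> * R1 + 1 * R2 \<le> \<beta> * pd + pc - pd * pc"
        by (rule hp[OF R]; use bound in \<open>simp add: add.commute\<close>)+
      then show ?thesis by simp
    qed
    then show "(R1, R2) \<in> outer1 pd pc"
      using box[OF R] by (simp add: outer1_def \<beta>_def)
  qed
  moreover have "capacity_region pd pc \<subseteq> outer2 pd pc" if mid: "pd / (1 + pd) \<le> pc" "pc \<le> pd"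
  proof (rule subrelI)
    fix R1 R2 assume R: "(R1, R2) \<in> capacity_region pd pc"
    show "(R1, R2) \<in> outer2 pd pc"
    proof (cases "pd = 0")
      \<comment> \<open>Here \<open>mid\<close> forces \<open>pc = 0\<close>, so
        \<open>pd / pc\<close> is 0 by the convention for division, and \<open>box\<close> leaves
        only the origin.\<close>
      case True
      then show ?thesis using box[OF R] mid assms by (simp add: outer2_def)
    next
      case False
      with assms have pos: "0 < pd" by simp
      moreover from pos have "0 < pd / (1 + pd)" by simp
      ultimately have pos: "0 < pd" "0 < pc" using mid by auto
      note sum_bound = moderate_interference_sum_bound[OF pos(1) assms(2-4) mid(1)]
      note weighted = moderate_interference_weighted_bound[OF pos(1) assms(2) pos(2) mid(2)]
      have "1 * R1 + 1 * R2 \<le> 2 * pc"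
        by (rule hp[OF R]; use sum_bound in simp)
      moreover have "1 * R1 + (pd / pc) * R2 \<le> (pd / pc) * (pd + pc - pd * pc)"
        "(pd / pc) * R1 + 1 * R2 \<le> (pd / pc) * (pd + pc - pd * pc)"
        using weighted by (intro hp[OF R]; force simp: add.commute)+
      ultimately show ?thesis using box[OF R] by (simp add: outer2_def)
    qed
  qed
  moreover have "capacity_region pd pc \<subseteq> outer3 pd pc" if strong: "pd \<le> pc"
  proof (rule subrelI)
    fix R1 R2 assume R: "(R1, R2) \<in> capacity_region pd pc"
    have "1 * R1 + 1 * R2 \<le> pd + pc - pd * pc"
      by (rule hp[OF R]; use strong_interference_bound[OF assms(1,4) strong] in simp)
    then show "(R1, R2) \<in> outer3 pd pc" using box[OF R] by (simp add: outer3_def)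
  qed
  ultimately show ?thesis by blast
qed

end
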